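(* Let $c\ge1$, $\lambda>0$, and let $G$ be a service-duration distribution on $(0,\infty)$ with $S\sim G$, $\mathbb{E}[S]<\infty$ and $\rho=\lambda\,\mathbb{E}[S]<c$. Let $\hat Y=(\hat Y_1,\dots,\hat Y_c)$ be a system of $c$ independent $M/G/1$ queues under the processor sharing discipline, each with Poisson arrivals of rate $\lambda/c$ and i.i.d. service durations with distribution $G$, started in statistical equilibrium at time $0$, and let $$\hat\tau=\inf\{t\ge 0:\ \hat Y_1,\dots,\hat Y_c \text{ are all empty at time } t\}.$$ Then $\mathbb{E}[\hat\tau]<\infty$ if and only if $\mathbb{E}[S^2]<\infty$.
   Context: Under processor sharing, a single server serves all customers present simultaneously, each at rate $1/(\text{number of customers present})$. The state of each $\hat Y_j$ records the residual service durations of the customers present. The time $\hat\tau$ is the run-time of the paper's first dominated coupling-from-the-past algorithm for the stable $M/G/c$ first-come-first-served queue with arrival rate $\lambda$ and service distribution $G$. *)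

theory Defs
  imports "HOL-Probability.Probability"
begin

text \<open>
  A queue state is the finite multiset of the residual service durations of the customers
  present. The sigma-algebra is the usual one for point configurations, generated by the
  counting maps of the Borel sets.
\<close>

definition config_space :: "real multiset measure" where
  "config_space = sigma UNIV
     {{X. size (filter_mset (\<lambda>x. x \<in> B) X) = n} | B n. B \<in> sets borel}"

text \<open>
  Processor sharing during a period of length \<open>t\<close> without arrivals: each of the \<open>n\<close> customers
  present is served at rate \<open>1 / n\<close>, so that the next departure (of everybody with the smallest
  residual \<open>m\<close>) takes place after time \<open>n * m\<close>.
\<close>

function ps_flow :: "real \<Rightarrow> real multiset \<Rightarrow> real multiset" where
  "ps_flow t X =
     (if X = {#} then {#}
      else let n = real (size X); m = Min_mset X in
        if t < n * m then image_mset (\<lambda>x. x - t / n) X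
        else ps_flow (t - n * m) (image_mset (\<lambda>x. x - m) (filter_mset (\<lambda>x. m < x) X)))"
  by pat_completeness auto
termination
proof (relation "Wellfounded.measure (\<lambda>(t, X). size X)", goal_cases)
  case (2 t X n m)
  then have "m \<in># X" by simp
  then have "filter_mset (\<lambda>x. m < x) X \<noteq> X"
    by (metis filter_mset_eq_conv less_irrefl)
  then have "filter_mset (\<lambda>x. m < x) X \<subset># X"
    by (simp add: subset_mset.less_le)
  then show ?case
    by (simp add: mset_subset_size)
qed simp

declare ps_flow.simps [simp del]

text \<open>
  The path of a processor sharing queue with initial state \<open>X\<close>, interarrival times
  \<open>a 0, a 1, \<dots>\<close> and service durations \<open>s 0, s 1, \<dots>\<close>; customer \<open>n\<close> arrives at time
  \<open>a 0 + \<dots> + a n\<close>. \<open>ps_post X a s n\<close> is the state immediately after the first \<open>n\<close> arrivals.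
  In \<open>arrivals\<close>, an infinite number of arrivals before time \<open>t\<close> (a null event below) counts as 0.
\<close>

primrec ps_post ::
    "real multiset \<Rightarrow> (nat \<Rightarrow> real) \<Rightarrow> (nat \<Rightarrow> real) \<Rightarrow> nat \<Rightarrow> real multiset" where
  "ps_post X a s 0 = X"
| "ps_post X a s (Suc n) = add_mset (s n) (ps_flow (a n) (ps_post X a s n))"

definition arrivals :: "(nat \<Rightarrow> real) \<Rightarrow> real \<Rightarrow> nat" where
  "arrivals a t = card {n. (\<Sum>i\<le>n. a i) \<le> t}"

definition ps_path ::
    "real multiset \<Rightarrow> (nat \<Rightarrow> real) \<Rightarrow> (nat \<Rightarrow> real) \<Rightarrow> real \<Rightarrow> real multiset" where
  "ps_path X a s t =
     (let k = arrivals a t in ps_flow (t - (\<Sum>i<k. a i)) (ps_post X a s k))"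

text \<open>
  \<open>X j\<close>, \<open>A j n\<close> and \<open>S j n\<close> are the initial state, the interarrival times and the service
  durations of queue \<open>j\<close>; arrivals are Poisson of rate \<open>r\<close>, that is, interarrival times are
  i.i.d. exponential. The variables take values in different types, so their mutual independence
  is expressed through the sigma-algebras they generate.
\<close>

datatype source = Initial nat | Interarrival nat nat | Service nat nat

locale mg1_ps_system = prob_space M
  for M :: "'w measure" +
  fixes c :: nat and r :: real and G :: "real measure"
    and X :: "nat \<Rightarrow> 'w \<Rightarrow> real multiset"
    and A :: "nat \<Rightarrow> nat \<Rightarrow> 'w \<Rightarrow> real"
    and S :: "nat \<Rightarrow> nat \<Rightarrow> 'w \<Rightarrow> real"
  assumes initial_measurable: "\<And>j. j < c \<Longrightarrow> X j \<in> M \<rightarrow>\<^sub>M config_space"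
    and initial_pos: "\<And>j. j < c \<Longrightarrow> AE \<omega> in M. \<forall>x \<in># X j \<omega>. 0 < x"
    and interarrival: "\<And>j n. j < c \<Longrightarrow> distributed M lborel (A j n) (exponential_density r)"
    and service_measurable: "\<And>j n. j < c \<Longrightarrow> S j n \<in> borel_measurable M"
    and service: "\<And>j n. j < c \<Longrightarrow> distr M borel (S j n) = G"
    and indep: "indep_sets
      (\<lambda>src. case src of
          Initial j \<Rightarrow> {X j -` B \<inter> space M | B. B \<in> sets config_space}
        | Interarrival j n \<Rightarrow> {A j n -` B \<inter> space M | B. B \<in> sets borel}
        | Service j n \<Rightarrow> {S j n -` B \<inter> space M | B. B \<in> sets borel})
      (\<Union>j<c. {Initial j} \<union> range (Interarrival j) \<union> range (Service j))"

definition ps_queue ::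
    "(nat \<Rightarrow> 'w \<Rightarrow> real multiset) \<Rightarrow> (nat \<Rightarrow> nat \<Rightarrow> 'w \<Rightarrow> real) \<Rightarrow> (nat \<Rightarrow> nat \<Rightarrow> 'w \<Rightarrow> real)
      \<Rightarrow> nat \<Rightarrow> real \<Rightarrow> 'w \<Rightarrow> real multiset" where
  "ps_queue X A S j t \<omega> = ps_path (X j \<omega>) (\<lambda>n. A j n \<omega>) (\<lambda>n. S j n \<omega>) t"

text \<open>
  A queue in the system is a time-homogeneous Markov process, hence it is in statistical
  equilibrium as soon as its one-dimensional marginal laws do not change with time.
\<close>

definition in_equilibrium :: "'w measure \<Rightarrow> (real \<Rightarrow> 'w \<Rightarrow> real multiset) \<Rightarrow> bool" where
  "in_equilibrium M Y \<longleftrightarrow>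
     (\<forall>t\<ge>0. Y t \<in> M \<rightarrow>\<^sub>M config_space \<and>
             distr M config_space (Y t) = distr M config_space (Y 0))"

definition all_empty_time ::
    "nat \<Rightarrow> (nat \<Rightarrow> real \<Rightarrow> 'w \<Rightarrow> real multiset) \<Rightarrow> 'w \<Rightarrow> ennreal" where
  "all_empty_time c Y \<omega> = (INF t \<in> {t. 0 \<le> t \<and> (\<forall>j<c. Y j t \<omega> = {#})}. ennreal t)"

end

theory Submission
  imports Defs
begin

text \<open>
  Processor sharing is work conserving, so each queue is empty exactly when its workload (the sum of
  the residual service durations) vanishes, and the workload is that of any work-conserving single
  server queue.

  If the mean of the hitting time is finite, so is the mean of the stationary workload \<open>W\<close>, which
  drains at rate at most 1. Comparing truncations of \<open>W\<^sup>2\<close> at times 0 and 1 in equilibrium, the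
  linear loss \<open>2 E W\<close> must pay for the contribution of the square of the first service
  duration, hence the second moment of \<open>G\<close> is finite.

  Conversely, if the second moment is finite, the expectation of \<open>W\<^sup>2\<close> decreases in a time unit by
  \<open>2 \<delta> W\<close> up to a constant, \<open>\<delta>\<close> being one minus the load. In equilibrium this bounds \<open>E W\<close>; for
  the \<open>c\<close> queues together it makes the Euclidean norm of the workload vector a Lyapunov function
  outside a ball (the sum of the workloads would not do, as an empty queue drifts upwards). From the
  ball all queues empty with positive probability, so a combination of the norm and of the indicator
  of the nonzero vectors bounds the mean hitting time linearly in the initial workloads.
\<close>

section \<open>Workload of a single queue\<close>

text \<open>One obstacle is continuous time: the Markov property is wanted at a fixed time, which
  falls inside an interarrival interval. Each queue is therefore driven by an i.i.d. sequence of
  marks (interarrival time, service duration), and the property becomes a statement about re-rooting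
  this sequence: by memorylessness the future seen from time \<open>t\<close> is a fresh copy of the
  input, whatever the workload at \<open>t\<close>. Probabilities and moments are then computed by
  induction on the number of arrivals up to a fixed time, peeling off the first mark. Fixed times
  suffice even for the state-dependent steps of the Lyapunov argument, whose length is determined by
  the current state. The other obstacle is that no moment of the stationary \<open>W\<close> is
  known in advance, so its square cannot simply be cancelled in an equilibrium identity. Both moment
  arguments compare bounded functions of \<open>W\<close> and remove the bound by monotone
  convergence.\<close>

type_synonym input = "nat \<Rightarrow> real \<times> real"

text \<open>Customer \<open>n\<close> arrives at \<open>epoch z (Suc n)\<close>; with the extra
  \<open>epoch z 0 = 0\<close>, \<open>arr z t\<close> is the index of the last epoch not exceeding
  \<open>t\<close>.\<close>

definition epoch :: "input \<Rightarrow> nat \<Rightarrow> real" where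
  "epoch z n = (\<Sum>i<n. fst (z i))"

definition arr :: "input \<Rightarrow> real \<Rightarrow> nat" where
  "arr z t = arrivals (\<lambda>n. fst (z n)) t"

text \<open>The almost sure event on which the path identities hold. Unbounded epochs exclude
  infinitely many arrivals in finite time, so the cardinality in \<open>arrivals\<close> is the true
  count.\<close>

definition regular :: "input \<Rightarrow> bool" where
  "regular z \<longleftrightarrow> (\<forall>n. 0 < fst (z n) \<and> 0 < snd (z n)) \<and> (\<forall>t. \<exists>n. t < epoch z n)"

text \<open>Lindley's recursion, indexed like \<open>ps_post\<close>.\<close>

primrec post_load :: "real \<Rightarrow> input \<Rightarrow> nat \<Rightarrow> real" where
  "post_load w z 0 = w"
| "post_load w z (Suc n) = snd (z n) + max 0 (post_load w z n - fst (z n))"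

definition workload :: "real \<Rightarrow> input \<Rightarrow> real \<Rightarrow> real" where
  "workload w z t = max 0 (post_load w z (arr z t) - (t - epoch z (arr z t)))"

text \<open>The input re-rooted at time \<open>t\<close>: only the interarrival interval straddling
  \<open>t\<close> changes, being cut down to its part after \<open>t\<close>. Memorylessness will
  apply to this part.\<close>

definition shift_input :: "real \<Rightarrow> input \<Rightarrow> input" where
  "shift_input t z = case_nat (epoch z (Suc (arr z t)) - t, snd (z (arr z t))) (\<lambda>n. z (Suc (arr z t) + n))"

definition load :: "input \<Rightarrow> real \<Rightarrow> real" where
  "load z t = (\<Sum>i<arr z t. snd (z i))"

section \<open>Arrival epochs and the arrival count\<close>

lemma epoch_0 [simp]: "epoch z 0 = 0"
  by (simp add: epoch_def)

lemma epoch_Suc: "epoch z (Suc n) = epoch z n + fst (z n)"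
  by (simp add: epoch_def)

lemma epoch_Suc_tail: "epoch z (Suc n) = fst (z 0) + epoch (\<lambda>n. z (Suc n)) n"
  unfolding epoch_def by (rule sum.lessThan_Suc_shift)

lemma arr_card: "arr z t = card {n. epoch z (Suc n) \<le> t}"
  by (simp add: arr_def arrivals_def epoch_def lessThan_Suc_atMost)

lemma strict_mono_epoch: "regular z \<Longrightarrow> strict_mono (epoch z)"
  by (rule strict_mono_Suc_iff[THEN iffD2]) (auto simp: epoch_Suc regular_def)

lemma finite_epochs:
  assumes "regular z" shows "finite {n. epoch z n \<le> t}"
proof -
  obtain m where m: "t < epoch z m" using assms unfolding regular_def by blast
  have "n < m" if "epoch z n \<le> t" for n
    using that m strict_mono_less[OF strict_mono_epoch[OF assms], of n m] by simp
  then have "{n. epoch z n \<le> t} \<subseteq> {..<m}" by auto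
  then show ?thesis by (rule finite_subset) simp
qed

lemma regular_tail:
  assumes "regular z" shows "regular (\<lambda>n. z (Suc n))"
  unfolding regular_def
proof (intro conjI allI)
  fix t
  obtain m where m: "t + fst (z 0) < epoch z m" using assms unfolding regular_def by blast
  then have "t + fst (z 0) < epoch z (Suc m)"
    using strict_mono_less[OF strict_mono_epoch[OF assms], of m "Suc m"] by simp
  then show "\<exists>n. t < epoch (\<lambda>n. z (Suc n)) n"
    by (intro exI[of _ m]) (simp add: epoch_Suc_tail)
qed (use assms in \<open>auto simp: regular_def\<close>)

lemma arr_eq_0: "regular z \<Longrightarrow> t < fst (z 0) \<Longrightarrow> arr z t = 0"
proof -
  assume g: "regular z" and t: "t < fst (z 0)"
  have "\<not> epoch z (Suc n) \<le> t" for n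
    using strict_mono_less_eq[OF strict_mono_epoch[OF g], of "Suc 0" "Suc n"] t
    by (simp add: epoch_Suc)
  then show ?thesis by (simp add: arr_card)
qed

lemma arr_tail:
  assumes g: "regular z" and t: "fst (z 0) \<le> t"
  shows "arr z t = Suc (arr (\<lambda>n. z (Suc n)) (t - fst (z 0)))"
proof -
  have eq: "{n. epoch z (Suc n) \<le> t} =
      insert 0 (Suc ` {n. epoch (\<lambda>n. z (Suc n)) (Suc n) \<le> t - fst (z 0)})" (is "_ = insert 0 (Suc ` ?A)")
  proof (rule set_eqI)
    fix n show "n \<in> {n. epoch z (Suc n) \<le> t} \<longleftrightarrow> n \<in> insert 0 (Suc ` ?A)"
      using t by (cases n) (auto simp: epoch_Suc_tail algebra_simps)
  qed
  have "finite ?A"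
    using finite_vimageI[OF finite_epochs[OF regular_tail[OF g], of "t - fst (z 0)"], of Suc]
    by (simp add: vimage_def)
  then show ?thesis unfolding arr_card eq by (simp add: card_image)
qed

lemma arr_split: "regular z \<Longrightarrow> arr z t = 0 \<longleftrightarrow> t < fst (z 0)"
  using arr_tail[of z t] arr_eq_0[of z t] by (cases "t < fst (z 0)") auto

section \<open>Restarting at the first arrival; flow property and pathwise bounds\<close>

lemma post_load_tail:
  "post_load w z (Suc n) = post_load (snd (z 0) + max 0 (w - fst (z 0))) (\<lambda>n. z (Suc n)) n"
  by (induction n) auto

lemma workload_before:
  "regular z \<Longrightarrow> t < fst (z 0) \<Longrightarrow> workload w z t = max 0 (w - t)"
  by (simp add: workload_def arr_eq_0)

lemma workload_after:
  "regular z \<Longrightarrow> fst (z 0) \<le> t \<Longrightarrow> workload w z t =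
     workload (snd (z 0) + max 0 (w - fst (z 0))) (\<lambda>n. z (Suc n)) (t - fst (z 0))"
  unfolding workload_def by (simp add: arr_tail epoch_Suc_tail post_load_tail algebra_simps del: post_load.simps(2))

lemma shift_before:
  "regular z \<Longrightarrow> t < fst (z 0) \<Longrightarrow> shift_input t z = case_nat (fst (z 0) - t, snd (z 0)) (\<lambda>n. z (Suc n))"
  by (simp add: shift_input_def arr_eq_0 epoch_Suc)

lemma shift_after:
  "regular z \<Longrightarrow> fst (z 0) \<le> t \<Longrightarrow> shift_input t z = shift_input (t - fst (z 0)) (\<lambda>n. z (Suc n))"
  unfolding shift_input_def
  by (simp only: arr_tail epoch_Suc_tail) (simp add: algebra_simps)

lemma load_before: "regular z \<Longrightarrow> t < fst (z 0) \<Longrightarrow> load z t = 0"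
  by (simp add: load_def arr_eq_0)

lemma load_after:
  "regular z \<Longrightarrow> fst (z 0) \<le> t \<Longrightarrow> load z t = snd (z 0) + load (\<lambda>n. z (Suc n)) (t - fst (z 0))"
  unfolding load_def arr_tail by (subst sum.lessThan_Suc_shift) simp

text \<open>Induction on \<open>arr z t\<close>. At the first arrival the queue restarts with a new
  workload, the tail of the input and less time, so \<open>w\<close>, \<open>z\<close> and
  \<open>t\<close> all have to vary.\<close>

lemma arrival_induct [consumes 1, case_names before after]:
  assumes "regular z"
    and before: "\<And>z t w. regular z \<Longrightarrow> t < fst (z 0) \<Longrightarrow> P w z t"
    and after: "\<And>z t w. regular z \<Longrightarrow> fst (z 0) \<le> t \<Longrightarrow>
       P (snd (z 0) + max 0 (w - fst (z 0))) (\<lambda>n. z (Suc n)) (t - fst (z 0)) \<Longrightarrow> P w z t"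
  shows "P w z t"
  using \<open>regular z\<close>
proof (induction "arr z t" arbitrary: w z t)
  case 0 then show ?case using before arr_split by metis
next
  case (Suc k)
  have le: "fst (z 0) \<le> t" using Suc.hyps(2) arr_eq_0[OF Suc.prems, of t] by (cases "t < fst (z 0)") auto
  show ?case
    by (rule after[OF Suc.prems le Suc.hyps(1)[OF _ regular_tail[OF Suc.prems]]])
       (use Suc.hyps(2) arr_tail[OF Suc.prems le] in simp)
qed

lemma workload_nonneg: "0 \<le> workload w z t"
  by (simp add: workload_def)

lemma regular_case_nat:
  assumes "regular z" "0 < a" "0 < s"
  shows "regular (case_nat (a, s) z)"
  unfolding regular_def
proof (intro conjI allI)
  fix t
  obtain m where "t - a < epoch z m" using assms unfolding regular_def by blast
  then show "\<exists>n. t < epoch (case_nat (a, s) z) n"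
    by (intro exI[of _ "Suc m"]) (simp add: epoch_Suc_tail)
qed (use assms in \<open>auto simp: regular_def split: nat.split\<close>)

lemma regular_shift:
  assumes "regular z" shows "regular (shift_input t z)"
  using assms
proof (rule arrival_induct[where P = "\<lambda>_ z t. regular (shift_input t z)"])
  fix z t assume "regular z" "t < fst (z 0)"
  then show "regular (shift_input t z)"
    by (subst shift_before) (auto intro!: regular_case_nat regular_tail simp: regular_def[of z])
qed (simp add: shift_after)

text \<open>Without an arrival by \<open>t\<close>, the time \<open>t\<close> merely cuts the first
  interval \<open>a\<close>, and draining in two stages changes nothing:
  \<open>max 0 (max 0 (w - t) - (a - t)) = max 0 (w - a)\<close>. Otherwise both sides restart at
  the first arrival.\<close>

lemma workload_add:
  assumes "regular z" "0 \<le> t" "0 \<le> u"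
  shows "workload w z (t + u) = workload (workload w z t) (shift_input t z) u"
  using assms
proof (induction w z t rule: arrival_induct)
  case (before z t w)
  have r: "regular (shift_input t z)" by (rule regular_shift) fact
  have s: "shift_input t z = case_nat (fst (z 0) - t, snd (z 0)) (\<lambda>n. z (Suc n))"
    using before by (simp add: shift_before)
  show ?case
  proof (cases "t + u < fst (z 0)")
    case True
    then show ?thesis using before r s
      by (simp add: workload_before)
  next
    case False
    have 1: "max 0 (max 0 (w - t) - (fst (z 0) - t)) = max 0 (w - fst (z 0))"
      using before by auto
    have "workload (workload w z t) (shift_input t z) u =
       workload (snd (z 0) + max 0 (max 0 (w - t) - (fst (z 0) - t))) (\<lambda>n. z (Suc n)) (u - (fst (z 0) - t))"
      using before r False by (subst workload_after) (auto simp: s workload_before)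
    also have "\<dots> = workload w z (t + u)"
      unfolding 1 using False before by (subst workload_after[of z]) (auto simp: algebra_simps)
    finally show ?thesis by simp
  qed
next
  case (after z t w)
  then show ?case
    by (simp add: workload_after shift_after algebra_simps)
qed

lemma workload_0: "regular z \<Longrightarrow> 0 \<le> w \<Longrightarrow> workload w z 0 = w"
  by (subst workload_before) (auto simp: regular_def)

text \<open>The right-hand side is what would remain if the server worked on the initial work
  only.\<close>

lemma workload_le_load:
  assumes "regular z" "0 \<le> t"
  shows "workload w z t \<le> max 0 (w - t) + load z t"
  using assms
proof (induction w z t rule: arrival_induct)
  case (after z t w)
  have "0 < snd (z 0)" using after by (simp add: regular_def)
  then show ?case using after by (simp add: workload_after load_after)
qed (simp add: workload_before load_before)

lemma workload_ge_drain:
  assumes "regular z" "0 \<le> t"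
  shows "w - t \<le> workload w z t"
  using assms
proof (induction w z t rule: arrival_induct)
  case (after z t w)
  have "0 < snd (z 0)" using after by (simp add: regular_def)
  then show ?case using after by (simp add: workload_after)
qed (simp add: workload_before)

text \<open>At most \<open>t\<close> units are served in total, so taking \<open>t\<close> off both
  the initial work and the first service is crude. The separated form lets the square of the service
  be isolated later.\<close>

lemma workload_ge_first_arrival:
  assumes "regular z" "0 \<le> t" "fst (z 0) \<le> t" "0 \<le> w"
  shows "max 0 (w - t) + max 0 (snd (z 0) - t) \<le> workload w z t"
proof -
  have p: "0 < fst (z 0)" "0 < snd (z 0)" using assms by (auto simp: regular_def)
  have "snd (z 0) + max 0 (w - fst (z 0)) - (t - fst (z 0)) \<le> workload w z t"
    using assms workload_ge_drain[OF regular_tail[OF assms(1)], of "t - fst (z 0)"]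
    by (simp add: workload_after)
  then show ?thesis using p assms workload_nonneg[of w z t] by (auto simp: max_def split: if_splits)
qed

section \<open>Processor sharing is work conserving\<close>

lemma ps_flow_pos:
  assumes "\<forall>x\<in>#X. 0 < x" "0 \<le> t"
  shows "\<forall>x\<in>#ps_flow t X. 0 < x"
  using assms
proof (induction t X rule: ps_flow.induct)
  case (1 t X)
  show ?case
  proof (cases "X = {#}")
    case False
    define n where "n = real (size X)"
    define m where "m = Min_mset X"
    have n: "n > 0" using False by (simp add: n_def nonempty_has_size)
    have m: "m \<in># X" "\<And>x. x \<in># X \<Longrightarrow> m \<le> x" using False by (auto simp: m_def)
    show ?thesis
    proof (cases "t < n * m")
      case True
      then have "t / n < m" using n by (simp add: field_simps)
      then have "0 < x - t / n" if "x \<in># X" for x using m(2)[OF that] by simp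
      then show ?thesis using False True
        by (subst ps_flow.simps) (auto simp: Let_def n_def[symmetric] m_def[symmetric])
    next
      case nt: False
      have IH: "\<forall>x\<in>#ps_flow (t - n * m) (image_mset (\<lambda>x. x - m) (filter_mset (\<lambda>x. m < x) X)). 0 < x"
        using "1.IH"[OF False n_def m_def nt] nt by simp
      then show ?thesis using False nt
        by (subst ps_flow.simps) (simp add: Let_def n_def[symmetric] m_def[symmetric])
    qed
  qed (simp add: ps_flow.simps)
qed

lemma sum_mset_diff_const:
  "sum_mset (image_mset (\<lambda>x. x - (m::real)) X) = sum_mset X - real (size X) * m"
  by (induction X) (auto simp: algebra_simps)

text \<open>\<open>n\<close> customers at rate \<open>1 / n\<close> drain the sum at rate 1. At a
  departure everybody has lost \<open>m\<close>, so \<open>n * m\<close> units are gone, and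
  removing those with residual \<open>m\<close> removes only zeros.\<close>

lemma sum_mset_ps_flow:
  assumes "\<forall>x\<in>#X. 0 < x" "0 \<le> t"
  shows "sum_mset (ps_flow t X) = max 0 (sum_mset X - t)"
  using assms
proof (induction t X rule: ps_flow.induct)
  case (1 t X)
  show ?case
  proof (cases "X = {#}")
    case False
    define n where "n = real (size X)"
    define m where "m = Min_mset X"
    have n: "n > 0" using False by (simp add: n_def nonempty_has_size)
    have m: "m \<in># X" "\<And>x. x \<in># X \<Longrightarrow> m \<le> x" using False by (auto simp: m_def)
    let ?Y = "image_mset (\<lambda>x. x - m) (filter_mset (\<lambda>x. m < x) X)"
    have split: "sum_mset (image_mset (\<lambda>x. x - m) X) = sum_mset ?Y"
    proof -
      have "sum_mset (image_mset (\<lambda>x. x - m) X) =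
        sum_mset (image_mset (\<lambda>x. if m < x then x - m else 0) X)"
        using m(2) by (intro arg_cong[where f = sum_mset] image_mset_cong) fastforce
      also have "\<dots> = sum_mset ?Y" by (induction X) auto
      finally show ?thesis .
    qed
    have Y: "sum_mset ?Y = sum_mset X - n * m"
      using split[symmetric] sum_mset_diff_const[of m X] by (simp only: n_def)
    have Y0: "0 \<le> sum_mset ?Y" by (induction X) auto
    show ?thesis
    proof (cases "t < n * m")
      case True
      then have "sum_mset (ps_flow t X) = sum_mset X - n * (t / n)"
        using False
        by (subst ps_flow.simps)
           (simp add: Let_def n_def[symmetric] m_def[symmetric] sum_mset_diff_const)
      also have "\<dots> = max 0 (sum_mset X - t)"
        using n Y Y0 True by simp
      finally show ?thesis .
    next
      case nt: False
      have "sum_mset (ps_flow (t - n * m) ?Y) = max 0 (sum_mset ?Y - (t - n * m))"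
        using "1.IH"[OF False n_def m_def nt] nt by simp
      then show ?thesis using False nt Y
        by (subst ps_flow.simps) (simp add: Let_def n_def[symmetric] m_def[symmetric])
    qed
  qed (use "1.prems" in \<open>simp add: ps_flow.simps\<close>)
qed

lemma ps_post_load:
  assumes "\<forall>x\<in>#X. 0 < x" "regular z"
  defines "Y \<equiv> ps_post X (\<lambda>n. fst (z n)) (\<lambda>n. snd (z n))"
  shows "(\<forall>x\<in>#Y n. 0 < x) \<and> sum_mset (Y n) = post_load (sum_mset X) z n"
proof (induction n)
  case (Suc n)
  have "0 < snd (z n)" "0 < fst (z n)" using assms by (auto simp: regular_def)
  then show ?case using Suc ps_flow_pos[of "Y n" "fst (z n)"] sum_mset_ps_flow[of "Y n" "fst (z n)"]
    by (auto simp: Y_def)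
qed (use assms in auto)

lemma epoch_arr_le:
  assumes "regular z" "0 \<le> t" shows "epoch z (arr z t) \<le> t"
proof -
  have "0 \<le> t \<longrightarrow> epoch z (arr z t) \<le> t"
    using assms(1)
  proof (rule arrival_induct[where P = "\<lambda>_ z t. 0 \<le> t \<longrightarrow> epoch z (arr z t) \<le> t"])
  qed (auto simp: arr_tail epoch_Suc_tail arr_eq_0)
  then show ?thesis using assms(2) by simp
qed

lemma ps_path_workload:
  assumes "\<forall>x\<in>#X. 0 < x" "regular z" "0 \<le> t"
  defines "Y \<equiv> ps_path X (\<lambda>n. fst (z n)) (\<lambda>n. snd (z n)) t"
  shows "(\<forall>x\<in>#Y. 0 < x) \<and> sum_mset Y = workload (sum_mset X) z t"
proof -
  have 1: "0 \<le> t - (\<Sum>i<arr z t. fst (z i))"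
    using epoch_arr_le[OF assms(2,3)] by (simp add: epoch_def)
  have 2: "Y = ps_flow (t - (\<Sum>i<arr z t. fst (z i)))
     (ps_post X (\<lambda>n. fst (z n)) (\<lambda>n. snd (z n)) (arr z t))"
    unfolding Y_def ps_path_def arr_def Let_def ..
  show ?thesis unfolding 2 workload_def
    using ps_flow_pos[OF _ 1] sum_mset_ps_flow[OF _ 1] ps_post_load[OF assms(1,2), of "arr z t"]
    by (auto simp: epoch_def)
qed

lemma sum_mset_pos_eq_0:
  fixes X :: "real multiset"
  assumes "\<forall>x\<in>#X. 0 < x" shows "sum_mset X = 0 \<longleftrightarrow> X = {#}"
proof (cases X)
  case (add x Y)
  have "\<forall>x\<in>#Y. 0 < x" using assms add by simp
  then have "0 \<le> sum_mset Y" by (induction Y) auto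
  then show ?thesis using assms add by auto
qed simp

section \<open>Measurability\<close>

abbreviation input_space :: "input measure" where
  "input_space \<equiv> PiM UNIV (\<lambda>_. borel \<Otimes>\<^sub>M borel)"

context
  fixes M :: "'a measure" and z :: "'a \<Rightarrow> input"
  assumes z [measurable]: "z \<in> M \<rightarrow>\<^sub>M input_space"
begin

lemma measurable_input_component: "(\<lambda>x. z x n) \<in> M \<rightarrow>\<^sub>M borel \<Otimes>\<^sub>M borel"
  using measurable_compose[OF z measurable_component_singleton[of n UNIV]] by simp

lemma measurable_epoch [measurable]: "(\<lambda>x. epoch (z x) n) \<in> borel_measurable M"
  using measurable_input_component[measurable] unfolding epoch_def by measurable

lemma measurable_arr [measurable]:
  assumes [measurable]: "t \<in> borel_measurable M"
  shows "(\<lambda>x. arr (z x) (t x)) \<in> M \<rightarrow>\<^sub>M count_space UNIV"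
  unfolding arr_card by measurable

lemma borel_measurable_arr [measurable]:
  assumes [measurable]: "t \<in> borel_measurable M"
  shows "(\<lambda>x. arr (z x) (t x)) \<in> borel_measurable M"
  by (rule measurable_compose[OF measurable_arr]) simp_all

lemma measurable_post_load [measurable]:
  assumes [measurable]: "w \<in> borel_measurable M"
  shows "(\<lambda>x. post_load (w x) (z x) n) \<in> borel_measurable M"
  using measurable_input_component[measurable] by (induction n) (simp_all, measurable)

text \<open>The index \<open>arr z t\<close> is random but takes countably many values, so it may be
  frozen first. The same device serves \<open>load\<close> and \<open>shift_input\<close>.\<close>

lemma measurable_workload [measurable]:
  assumes [measurable]: "w \<in> borel_measurable M" "t \<in> borel_measurable M"
  shows "(\<lambda>x. workload (w x) (z x) (t x)) \<in> borel_measurable M"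
  unfolding workload_def
  by (rule measurable_compose_countable[where g = "\<lambda>x. arr (z x) (t x)"]) measurable

lemma measurable_load [measurable]:
  assumes [measurable]: "t \<in> borel_measurable M"
  shows "(\<lambda>x. load (z x) (t x)) \<in> borel_measurable M"
  unfolding load_def
proof (rule measurable_compose_countable[where g = "\<lambda>x. arr (z x) (t x)"])
  note measurable_input_component[measurable]
  show "(\<lambda>x. \<Sum>i<k. snd (z x i)) \<in> borel_measurable M" for k by measurable
qed measurable

lemma measurable_shift [measurable]:
  assumes [measurable]: "t \<in> borel_measurable M"
  shows "(\<lambda>x. shift_input (t x) (z x)) \<in> M \<rightarrow>\<^sub>M input_space"
  unfolding shift_input_def
proof (rule measurable_compose_countable[where g = "\<lambda>x. arr (z x) (t x)"])
  fix k
  note measurable_input_component[measurable]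
  have "(\<lambda>x n. z x (Suc k + n)) \<in> M \<rightarrow>\<^sub>M input_space"
    by (rule measurable_abs_UNIV) measurable
  then show "(\<lambda>x. case_nat (epoch (z x) (Suc k) - t x, snd (z x k)) (\<lambda>n. z x (Suc k + n)))
      \<in> M \<rightarrow>\<^sub>M input_space"
    by measurable
qed measurable

end

section \<open>The exponential distribution\<close>

locale mg1_input =
  fixes r :: real and G :: "real measure"
  assumes rate_pos: "0 < r" and service_dist: "real_distribution G" and service_pos: "AE x in G. 0 < x"
begin

definition expo :: "real measure" where
  "expo = density lborel (\<lambda>x. ennreal (exponential_density r x))"

definition input :: "input measure" where
  "input = PiM UNIV (\<lambda>_. expo \<Otimes>\<^sub>M G)"

sublocale G: real_distribution G
  by (rule service_dist)

sublocale expo: prob_space expo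
  unfolding expo_def by (rule prob_space_exponential_density) (rule rate_pos)

lemma sets_expo [measurable_cong, simp]: "sets expo = sets borel"
  by (simp add: expo_def)

lemma space_expo [simp]: "space expo = UNIV"
  by (simp add: expo_def)

lemma sets_G [measurable_cong]: "sets G = sets borel"
  by simp

sublocale mark: pair_prob_space expo G ..

sublocale marks: sequence_space "expo \<Otimes>\<^sub>M G" ..

sublocale input: prob_space input
  unfolding input_def by (rule marks.P.prob_space_axioms)

lemma sets_input [measurable_cong]: "sets input = sets input_space"
  unfolding input_def by (intro sets_PiM_cong sets_pair_measure_cong) auto

lemma space_input [simp]: "space input = UNIV"
  using sets_eq_imp_space_eq[OF sets_input] by (simp add: space_PiM space_pair_measure)

text \<open>An i.i.d. sequence is its first mark followed by an independent copy of the whole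
  sequence; every probabilistic induction on arrivals rests on this.\<close>

lemma nn_integral_input_iterate:
  assumes [measurable]: "f \<in> borel_measurable input_space"
  shows "(\<integral>\<^sup>+z. f z \<partial>input) = (\<integral>\<^sup>+a. \<integral>\<^sup>+s. \<integral>\<^sup>+z. f (case_nat (a, s) z) \<partial>input \<partial>G \<partial>expo)"
proof -
  have m: "f \<in> borel_measurable (PiM UNIV (\<lambda>_. expo \<Otimes>\<^sub>M G))"
    using assms unfolding measurable_cong_sets[OF sets_input[symmetric] refl] input_def .
  have "(\<integral>\<^sup>+z. f z \<partial>input) =
      (\<integral>\<^sup>+p. f ((\<lambda>(s, \<omega>). case_nat s \<omega>) p) \<partial>((expo \<Otimes>\<^sub>M G) \<Otimes>\<^sub>M input))"
    unfolding input_def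
    by (subst marks.PiM_iter[symmetric], rule nn_integral_distr) (use m in measurable)
  also have "\<dots> = (\<integral>\<^sup>+x. \<integral>\<^sup>+z. f (case_nat x z) \<partial>input \<partial>(expo \<Otimes>\<^sub>M G))"
    by (subst input.nn_integral_fst[symmetric]) (simp_all add: case_prod_beta)
  also have "\<dots> = (\<integral>\<^sup>+a. \<integral>\<^sup>+s. \<integral>\<^sup>+z. f (case_nat (a, s) z) \<partial>input \<partial>G \<partial>expo)"
    by (subst G.nn_integral_fst[symmetric]) simp_all
  finally show ?thesis .
qed

section \<open>Exponential interarrival times: memorylessness and the renewal equation\<close>

lemma nn_integral_expo:
  assumes [measurable]: "f \<in> borel_measurable borel"
  shows "(\<integral>\<^sup>+a. f a \<partial>expo) = (\<integral>\<^sup>+a. ennreal (exponential_density r a) * f a \<partial>lborel)"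
  unfolding expo_def by (rule nn_integral_density) simp_all

lemma AE_expo_pos: "AE a in expo. 0 < a"
proof -
  have "AE a in lborel. a \<noteq> (0::real)" by (rule AE_lborel_singleton)
  then have "AE a in lborel. 0 < ennreal (exponential_density r a) \<longrightarrow> 0 < a"
    by eventually_elim (auto simp: exponential_density_def)
  then show ?thesis unfolding expo_def by (subst AE_density) auto
qed

text \<open>Translating the variable by \<open>t\<close> splits the factor
  \<open>exp (- r * t)\<close> off the density: the excess over \<open>t\<close> has the original
  law.\<close>

lemma memoryless:
  assumes [measurable]: "h \<in> borel_measurable borel" and t: "0 \<le> t"
  shows "(\<integral>\<^sup>+a. indicator {t<..} a * h (a - t) \<partial>expo) = ennreal (exp (- r * t)) * (\<integral>\<^sup>+a. h a \<partial>expo)"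
proof -
  have "(\<integral>\<^sup>+a. indicator {t<..} a * h (a - t) \<partial>expo) =
      (\<integral>\<^sup>+a. ennreal (exponential_density r a) * (indicator {t<..} a * h (a - t)) \<partial>lborel)"
    by (rule nn_integral_expo) measurable
  also have "\<dots> = (\<integral>\<^sup>+a. ennreal (exponential_density r (t + a)) * (indicator {t<..} (t + a) * h (t + a - t)) \<partial>lborel)"
    by (subst nn_integral_real_affine[where c = 1 and t = t]) auto
  also have "\<dots> = (\<integral>\<^sup>+a. ennreal (exp (- r * t)) * (ennreal (exponential_density r a) * h a) \<partial>lborel)"
  proof (rule nn_integral_cong_AE)
    \<comment> \<open>The point \<open>a = 0\<close> is set aside because the strict indicator
      vanishes there while the density does not.\<close>
    have "AE a in lborel. a \<noteq> (0::real)" by (rule AE_lborel_singleton)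
    then show "AE a in lborel. ennreal (exponential_density r (t + a)) * (indicator {t<..} (t + a) * h (t + a - t)) =
      ennreal (exp (- r * t)) * (ennreal (exponential_density r a) * h a)"
    proof eventually_elim
      case (elim a)
      show ?case
      proof (cases "0 < a")
        case True
        then have "exponential_density r (t + a) = exp (- r * t) * exponential_density r a"
          using t by (simp add: exponential_density_def exp_add[symmetric] algebra_simps)
        then show ?thesis using True rate_pos
          by (simp add: ennreal_mult exponential_density_nonneg mult.assoc)
      qed (use elim in \<open>simp add: exponential_density_def\<close>)
    qed
  qed
  also have "\<dots> = ennreal (exp (- r * t)) * (\<integral>\<^sup>+a. h a \<partial>expo)"
    by (subst nn_integral_cmult) (simp_all add: nn_integral_expo)
  finally show ?thesis .
qed

lemma emeasure_expo_greater:
  assumes "0 \<le> t" shows "emeasure expo {t<..} = ennreal (exp (- r * t))"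
  using memoryless[of "\<lambda>_. 1" t] assms expo.emeasure_space_1 by simp

text \<open>The renewal equation for the expected number \<open>r * t\<close> of arrivals: the first
  one, at time \<open>a\<close>, counts 1, and \<open>r * (t - a)\<close> more are expected. It
  closes the inductions for the moments of the load.\<close>

lemma expo_renewal:
  assumes t: "0 \<le> t"
  shows "(\<integral>\<^sup>+a. indicator {..t} a * ennreal (1 + r * (t - a)) \<partial>expo) = ennreal (r * t)"
proof -
  have "(\<integral>\<^sup>+a. indicator {..t} a * ennreal (1 + r * (t - a)) \<partial>expo) =
      (\<integral>\<^sup>+a. ennreal (exponential_density r a) * (indicator {..t} a * ennreal (1 + r * (t - a))) \<partial>lborel)"
    by (rule nn_integral_expo) measurable
  also have "\<dots> = (\<integral>\<^sup>+a. ennreal (r * exp (- r * a) * (1 + r * (t - a))) * indicator {0..t} a \<partial>lborel)"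
    using rate_pos by (intro nn_integral_cong)
      (auto simp: exponential_density_def indicator_def ennreal_mult mult_ac)
  \<comment> \<open>The antiderivative is \<open>- exp (- r * a) * (r * (t - a))\<close>.\<close>
  also have "\<dots> = ennreal ((- exp (- r * t) * (r * (t - t))) - (- exp (- r * 0) * (r * (t - 0))))"
    using rate_pos t
    by (intro nn_integral_FTC_Icc mult_nonneg_nonneg add_nonneg_nonneg)
       (auto intro!: derivative_eq_intros simp: algebra_simps)
  also have "\<dots> = ennreal (r * t)" by simp
  finally show ?thesis .
qed

section \<open>Almost sure regularity of the input\<close>

lemma AE_mark_pos: "AE x in expo \<Otimes>\<^sub>M G. 0 < fst x \<and> 0 < snd x"
proof (rule mark.AE_pair_measure)
  show "AE x in expo. AE y in G. 0 < fst (x, y) \<and> 0 < snd (x, y)"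
    using AE_expo_pos service_pos by (auto elim!: eventually_mono)
qed measurable

text \<open>For every \<open>T\<close> some interarrival time exceeds \<open>T\<close>, since each
  does so independently with the same positive probability; a single such interval already pushes an
  epoch beyond \<open>T\<close>. No law of large numbers is needed.\<close>

lemma AE_regular: "AE z in input. regular z"
proof -
  have pos: "AE z in input. \<forall>n. 0 < fst (z n) \<and> 0 < snd (z n)"
    unfolding AE_all_countable input_def
    by (intro allI AE_PiM_component[where P = "\<lambda>x. 0 < fst x \<and> 0 < snd x"] AE_mark_pos)
       (auto intro: mark.prob_space_axioms)
  have unb: "AE z in input. \<exists>n. real T < fst (z n)" for T :: nat
  proof -
    let ?E = "\<lambda>_::nat. {x :: real \<times> real. fst x \<le> real T}"
    define p where "p = measure (expo \<Otimes>\<^sub>M G) (?E 0)"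
    have E: "?E i \<in> sets (expo \<Otimes>\<^sub>M G)" for i
    proof -
      have "{x \<in> space (expo \<Otimes>\<^sub>M G). fst x \<le> real T} \<in> sets (expo \<Otimes>\<^sub>M G)" by measurable
      then show ?thesis by (simp add: space_pair_measure)
    qed
    have c: "emeasure (expo \<Otimes>\<^sub>M G) ({real T<..} \<times> UNIV) = ennreal (exp (- r * T))"
      using G.emeasure_space_1 by (subst G.emeasure_pair_measure_Times) (simp_all add: emeasure_expo_greater)
    have "measure (expo \<Otimes>\<^sub>M G) (space (expo \<Otimes>\<^sub>M G) - ?E 0) = exp (- r * T)"
    proof -
      have "space (expo \<Otimes>\<^sub>M G) - ?E 0 = {real T<..} \<times> UNIV" by (auto simp: space_pair_measure)
      then show ?thesis using c by (simp add: measure_def)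
    qed
    then have "p = 1 - exp (- r * T)" using mark.prob_compl[OF E] by (simp add: p_def)
    then have "p < 1" by simp
    moreover have "0 \<le> p" by (simp add: p_def)
    \<comment> \<open>The product is the probability that the first \<open>n + 1\<close>
      interarrival times are all at most \<open>T\<close>.\<close>
    ultimately have "(\<lambda>n. \<Prod>i\<le>n. p) \<longlonglongrightarrow> 0"
      using LIMSEQ_power_zero[of p, THEN LIMSEQ_Suc] by simp
    then have "measure input (Pi UNIV ?E) = 0"
      using LIMSEQ_unique[OF marks.measure_PiM_countable[of ?E, OF E]] by (simp add: p_def input_def)
    moreover have S: "Pi UNIV ?E \<in> sets input"
    proof -
      have "Pi UNIV ?E = {z \<in> space input. \<forall>n. fst (z n) \<le> real T}" by auto
      also have "\<dots> \<in> sets input" by measurable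
      finally show ?thesis .
    qed
    ultimately have "AE z in input. z \<notin> Pi UNIV ?E"
      by (intro AE_not_in) (auto simp: null_sets_def input.emeasure_eq_measure)
    then show ?thesis by eventually_elim (auto simp: not_le)
  qed
  have "AE z in input. \<forall>T::nat. \<exists>n. real T < fst (z n)"
    unfolding AE_all_countable using unb by blast
  with pos show ?thesis
  proof eventually_elim
    case (elim z)
    have "\<exists>n. t < epoch z n" for t
    proof -
      obtain T :: nat where T: "t < real T" using reals_Archimedean2 by blast
      obtain n where n: "real T < fst (z n)" using elim by blast
      have "0 \<le> epoch z n" unfolding epoch_def using elim by (intro sum_nonneg) (auto intro: less_imp_le)
      then have "t < epoch z (Suc n)" using T n by (simp add: epoch_Suc)
      then show ?thesis by blast
    qed
    then show ?case using elim by (simp add: regular_def)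
  qed
qed

section \<open>Conditioning on the first arrival; the Markov property at a fixed time\<close>

lemma nn_integral_input_iterate_regular:
  assumes [measurable]: "f \<in> borel_measurable input_space"
    and "\<And>a s z. 0 < a \<Longrightarrow> 0 < s \<Longrightarrow> regular z \<Longrightarrow> f (case_nat (a, s) z) = g a s z"
  shows "(\<integral>\<^sup>+z. f z \<partial>input) = (\<integral>\<^sup>+a. \<integral>\<^sup>+s. \<integral>\<^sup>+z. g a s z \<partial>input \<partial>G \<partial>expo)"
  unfolding nn_integral_input_iterate[OF assms(1)]
  using AE_expo_pos
  apply (intro nn_integral_cong_AE, eventually_elim)
  subgoal for a using service_pos
    apply (intro nn_integral_cong_AE, eventually_elim)
    subgoal for s using AE_regular
      by (intro nn_integral_cong_AE, eventually_elim) (rule assms(2))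
    done
  done

text \<open>Memorylessness settles the case without arrivals. With at least one, integrating over
  the first mark leaves the claim for one arrival fewer, at another workload and remaining time;
  hence \<open>w\<close> and \<open>t\<close> are arbitrary in the induction.\<close>

lemma markov_arrivals:
  assumes [measurable]: "F \<in> borel_measurable (borel \<Otimes>\<^sub>M input_space)" and t: "0 \<le> t"
  shows "(\<integral>\<^sup>+z. indicator {n} (arr z t) * F (workload w z t, shift_input t z) \<partial>input) =
    (\<integral>\<^sup>+z. indicator {n} (arr z t) * (\<integral>\<^sup>+z'. F (workload w z t, z') \<partial>input) \<partial>input)"
  using t
proof (induction n arbitrary: t w)
  case 0
  have multc: "(\<integral>\<^sup>+a. indicator {t<..} a * C \<partial>expo) = ennreal (exp (- r * t)) * C" for C :: ennreal
    using 0 by (subst nn_integral_multc, measurable) (simp_all add: emeasure_expo_greater)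
  \<comment> \<open>Without an arrival the workload at \<open>t\<close> is this constant; only the
    residual interval and the marks are random.\<close>
  define m where "m = max 0 (w - t)"
  define g where "g a = (\<integral>\<^sup>+s. \<integral>\<^sup>+z. F (m, case_nat (a, s) z) \<partial>input \<partial>G)" for a
  have [measurable]: "g \<in> borel_measurable borel" unfolding g_def by measurable
  have I: "(\<integral>\<^sup>+a. g a \<partial>expo) = (\<integral>\<^sup>+z. F (m, z) \<partial>input)"
    unfolding g_def by (subst nn_integral_input_iterate) simp_all
  have "(\<integral>\<^sup>+z. indicator {0} (arr z t) * F (workload w z t, shift_input t z) \<partial>input) =
     (\<integral>\<^sup>+a. \<integral>\<^sup>+s. \<integral>\<^sup>+z. indicator {t<..} a * F (m, case_nat (a - t, s) z) \<partial>input \<partial>G \<partial>expo)"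
    by (rule nn_integral_input_iterate_regular)
       (auto simp: m_def regular_case_nat arr_split workload_before shift_before indicator_def)
  also have "\<dots> = (\<integral>\<^sup>+a. indicator {t<..} a * g (a - t) \<partial>expo)"
    unfolding g_def by (intro nn_integral_cong) (auto simp: indicator_def)
  also have "\<dots> = ennreal (exp (- r * t)) * (\<integral>\<^sup>+z. F (m, z) \<partial>input)"
    using 0 by (subst memoryless) (simp_all add: I)
  also have "\<dots> = (\<integral>\<^sup>+a. \<integral>\<^sup>+s. \<integral>\<^sup>+z. indicator {t<..} a * (\<integral>\<^sup>+z'. F (m, z') \<partial>input) \<partial>input \<partial>G \<partial>expo)"
    using 0 G.emeasure_space_1 input.emeasure_space_1
    by (simp add: multc)
  also have "\<dots> = (\<integral>\<^sup>+z. indicator {0} (arr z t) * (\<integral>\<^sup>+z'. F (workload w z t, z') \<partial>input) \<partial>input)"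
    by (rule nn_integral_input_iterate_regular[symmetric])
       (auto simp: m_def regular_case_nat arr_split workload_before indicator_def)
  finally show ?case .
next
  case (Suc n)
  \<comment> \<open>Both sides have this form, with \<open>K\<close> being \<open>F\<close> or the
    average of \<open>F\<close> over a fresh input, so one computation serves both.\<close>
  let ?H = "\<lambda>K. \<lambda>a s z. indicator {..t} a * (indicator {n} (arr z (t - a)) *
      K (workload (s + max 0 (w - a)) z (t - a)) (shift_input (t - a) z))"
  have step: "(\<integral>\<^sup>+z. indicator {Suc n} (arr z t) * K (workload w z t) (shift_input t z) \<partial>input) =
     (\<integral>\<^sup>+a. \<integral>\<^sup>+s. \<integral>\<^sup>+z. ?H K a s z \<partial>input \<partial>G \<partial>expo)"
    if [measurable]: "(\<lambda>(x, z). K x z) \<in> borel_measurable (borel \<Otimes>\<^sub>M input_space)"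
    for K :: "real \<Rightarrow> input \<Rightarrow> ennreal"
  proof (rule nn_integral_input_iterate_regular)
    show "(\<lambda>z. indicator {Suc n} (arr z t) * K (workload w z t) (shift_input t z)) \<in> borel_measurable input_space"
      by measurable
    fix a s z assume "0 < (a::real)" "0 < (s::real)" "regular z"
    then show "indicator {Suc n} (arr (case_nat (a, s) z) t) *
        K (workload w (case_nat (a, s) z) t) (shift_input t (case_nat (a, s) z)) = ?H K a s z"
      by (cases "a \<le> t")
         (simp_all add: regular_case_nat arr_tail arr_eq_0 workload_after shift_after indicator_def)
  qed
  have "(\<integral>\<^sup>+z. ?H (\<lambda>x z. F (x, z)) a s z \<partial>input) = (\<integral>\<^sup>+z. ?H (\<lambda>x z. \<integral>\<^sup>+z'. F (x, z') \<partial>input) a s z \<partial>input)"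
    for a s
    using Suc.IH[of "t - a" "s + max 0 (w - a)"] by (cases "a \<le> t") simp_all
  then show ?case
    using step[of "\<lambda>x z. F (x, z)"] step[of "\<lambda>x z. \<integral>\<^sup>+z'. F (x, z') \<partial>input"] by simp
qed

lemma nn_integral_split_arr:
  assumes [measurable]: "f \<in> borel_measurable input_space"
  shows "(\<integral>\<^sup>+z. f z \<partial>input) = (\<Sum>n. \<integral>\<^sup>+z. indicator {n} (arr z t) * f z \<partial>input)"
proof -
  have 1: "f z = (\<Sum>n. indicator {n} (arr z t) * f z)" for z
  proof -
    have "(\<Sum>n. indicator {n} (arr z t) * f z) = (\<Sum>n\<in>{arr z t}. indicator {n} (arr z t) * f z)"
      by (rule suminf_finite) (auto simp: indicator_def)
    then show ?thesis by simp
  qed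
  have "(\<integral>\<^sup>+z. f z \<partial>input) = (\<integral>\<^sup>+z. (\<Sum>n. indicator {n} (arr z t) * f z) \<partial>input)"
    by (rule nn_integral_cong) (rule 1)
  also have "\<dots> = (\<Sum>n. \<integral>\<^sup>+z. indicator {n} (arr z t) * f z \<partial>input)"
    by (rule nn_integral_suminf) measurable
  finally show ?thesis .
qed

theorem markov:
  assumes [measurable]: "F \<in> borel_measurable (borel \<Otimes>\<^sub>M input_space)" and t: "0 \<le> t"
  shows "(\<integral>\<^sup>+z. F (workload w z t, shift_input t z) \<partial>input) =
    (\<integral>\<^sup>+z. \<integral>\<^sup>+z'. F (workload w z t, z') \<partial>input \<partial>input)"
  using markov_arrivals[OF assms, of _ w]
    nn_integral_split_arr[of "\<lambda>z. F (workload w z t, shift_input t z)" t]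
    nn_integral_split_arr[of "\<lambda>z. \<integral>\<^sup>+z'. F (workload w z t, z') \<partial>input" t]
  by simp

section \<open>Moments of the arriving work\<close>

lemma ennreal_add_le: "ennreal (x + y) \<le> ennreal x + ennreal y"
proof -
  have "ennreal (x + y) \<le> ennreal (max 0 x + max 0 y)" by (rule ennreal_leI) auto
  also have "\<dots> = ennreal x + ennreal y" by (subst ennreal_plus) auto
  finally show ?thesis .
qed

text \<open>The inductions control only the event of fewer than \<open>n\<close> arrivals. As their
  bounds do not depend on \<open>n\<close>, monotone convergence removes the restriction.\<close>

lemma nn_integral_le_truncated:
  assumes [measurable]: "f \<in> borel_measurable input_space"
    and le: "\<And>n. (\<integral>\<^sup>+z. indicator {..<n} (arr z t) * f z \<partial>input) \<le> C"
  shows "(\<integral>\<^sup>+z. f z \<partial>input) \<le> C"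
proof -
  have "f z = (SUP n. indicator {..<n} (arr z t) * f z)" for z
    by (intro antisym SUP_upper2[of "Suc (arr z t)"] SUP_least) (auto simp: indicator_def)
  then have "(\<integral>\<^sup>+z. f z \<partial>input) = (\<integral>\<^sup>+z. (SUP n. indicator {..<n} (arr z t) * f z) \<partial>input)"
    by simp
  also have "\<dots> = (SUP n. \<integral>\<^sup>+z. indicator {..<n} (arr z t) * f z \<partial>input)"
    by (intro nn_integral_monotone_convergence_SUP)
       (auto simp: incseq_def le_fun_def indicator_def)
  finally show ?thesis using le by (simp add: SUP_least)
qed

lemma load_nonneg: "regular z \<Longrightarrow> 0 \<le> load z t"
  unfolding load_def by (intro sum_nonneg) (auto simp: regular_def intro: less_imp_le)

context
  fixes m :: real
  assumes m: "0 \<le> m" and mean_le: "(\<integral>\<^sup>+s. ennreal s \<partial>G) \<le> ennreal m"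
begin

text \<open>The upper bound in Wald's identity. After a first arrival at \<open>a\<close>, the
  service contributes at most \<open>m\<close> in mean and the rest at most
  \<open>r * (t - a) * m\<close>; together this is \<open>m\<close> times the integrand of
  \<open>expo_renewal\<close>.\<close>

lemma nn_integral_load_truncated:
  assumes "0 \<le> t"
  shows "(\<integral>\<^sup>+z. indicator {..<n} (arr z t) * ennreal (load z t) \<partial>input) \<le> ennreal (r * t * m)"
  using assms
proof (induction n arbitrary: t)
  case (Suc n)
  have "(\<integral>\<^sup>+z. indicator {..<Suc n} (arr z t) * ennreal (load z t) \<partial>input) =
     (\<integral>\<^sup>+a. \<integral>\<^sup>+s. \<integral>\<^sup>+z. indicator {..t} a * (indicator {..<n} (arr z (t - a)) * ennreal (s + load z (t - a))) \<partial>input \<partial>G \<partial>expo)"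
  proof (rule nn_integral_input_iterate_regular)
    fix a s z assume "0 < (a::real)" "0 < (s::real)" "regular z"
    then show "indicator {..<Suc n} (arr (case_nat (a, s) z) t) * ennreal (load (case_nat (a, s) z) t) =
        indicator {..t} a * (indicator {..<n} (arr z (t - a)) * ennreal (s + load z (t - a)))"
      by (cases "a \<le> t")
         (simp_all add: regular_case_nat arr_tail load_after load_before indicator_def)
  qed measurable
  also have "\<dots> \<le> (\<integral>\<^sup>+a. \<integral>\<^sup>+s. indicator {..t} a * (ennreal s + ennreal (r * (t - a) * m)) \<partial>G \<partial>expo)"
  proof (intro nn_integral_mono)
    fix a s
    show "(\<integral>\<^sup>+z. indicator {..t} a * (indicator {..<n} (arr z (t - a)) * ennreal (s + load z (t - a))) \<partial>input)
      \<le> indicator {..t} a * (ennreal s + ennreal (r * (t - a) * m))"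
    proof (cases "a \<le> t")
      case True
      have "(\<integral>\<^sup>+z. indicator {..<n} (arr z (t - a)) * ennreal (s + load z (t - a)) \<partial>input) \<le>
        (\<integral>\<^sup>+z. ennreal s + indicator {..<n} (arr z (t - a)) * ennreal (load z (t - a)) \<partial>input)"
        by (intro nn_integral_mono) (auto simp: indicator_def ennreal_add_le)
      also have "\<dots> = ennreal s + (\<integral>\<^sup>+z. indicator {..<n} (arr z (t - a)) * ennreal (load z (t - a)) \<partial>input)"
        using input.emeasure_space_1 by (subst nn_integral_add) auto
      finally show ?thesis using True Suc.IH[of "t - a"] by (auto intro: order_trans add_left_mono)
    qed simp
  qed
  also have "\<dots> \<le> (\<integral>\<^sup>+a. ennreal m * (indicator {..t} a * ennreal (1 + r * (t - a))) \<partial>expo)"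
  proof (intro nn_integral_mono)
    fix a
    show "(\<integral>\<^sup>+s. indicator {..t} a * (ennreal s + ennreal (r * (t - a) * m)) \<partial>G)
      \<le> ennreal m * (indicator {..t} a * ennreal (1 + r * (t - a)))"
    proof (cases "a \<le> t")
      case True
      have "(\<integral>\<^sup>+s. ennreal s + ennreal (r * (t - a) * m) \<partial>G) = (\<integral>\<^sup>+s. ennreal s \<partial>G) + ennreal (r * (t - a) * m)"
        using G.emeasure_space_1 by (subst nn_integral_add) auto
      also have "\<dots> \<le> ennreal m + ennreal (r * (t - a) * m)"
        using mean_le by (rule add_right_mono)
      also have "\<dots> = ennreal (m + r * (t - a) * m)"
        using m True rate_pos by simp
      also have "m + r * (t - a) * m = m * (1 + r * (t - a))"
        by (simp add: algebra_simps)
      also have "ennreal \<dots> = ennreal m * ennreal (1 + r * (t - a))"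
        using m True rate_pos by (intro ennreal_mult) auto
      finally show ?thesis using True by simp
    qed simp
  qed
  also have "\<dots> = ennreal m * (\<integral>\<^sup>+a. indicator {..t} a * ennreal (1 + r * (t - a)) \<partial>expo)"
    by (rule nn_integral_cmult) measurable
  also have "\<dots> = ennreal (r * t * m)"
    using Suc.prems m rate_pos by (simp add: expo_renewal ennreal_mult[symmetric] mult_ac)
  finally show ?case .
qed (simp add: indicator_def)

lemma nn_integral_load:
  assumes "0 \<le> t"
  shows "(\<integral>\<^sup>+z. ennreal (load z t) \<partial>input) \<le> ennreal (r * t * m)"
proof (rule nn_integral_le_truncated)
  show "(\<lambda>z. ennreal (load z t)) \<in> borel_measurable input_space" by measurable
qed (rule nn_integral_load_truncated[OF assms])

text \<open>Expanding the square at the first arrival leaves a cross term of mean at most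
  \<open>2 * m * (r * T * m)\<close>. The separate horizon \<open>T\<close> keeps this constant
  fixed while \<open>t\<close> shrinks in the induction, which then closes by
  \<open>expo_renewal\<close> as for the mean.\<close>

lemma nn_integral_load_square_truncated:
  assumes q: "0 \<le> q" and square_le: "(\<integral>\<^sup>+s. ennreal (s\<^sup>2) \<partial>G) \<le> ennreal q"
    and "0 \<le> t" "t \<le> T"
  shows "(\<integral>\<^sup>+z. indicator {..<n} (arr z t) * ennreal ((load z t)\<^sup>2) \<partial>input)
    \<le> ennreal (r * t * (q + 2 * m * (r * T * m)))"
  using assms(3,4)
proof (induction n arbitrary: t)
  case (Suc n)
  define K where "K = q + 2 * m * (r * T * m)"
  have K: "0 \<le> K" using q m rate_pos Suc.prems by (simp add: K_def)
  let ?L = "\<lambda>a z. indicator {..<n} (arr z (t - a)) * ennreal (load z (t - a))"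
  let ?Q = "\<lambda>a z. indicator {..<n} (arr z (t - a)) * ennreal ((load z (t - a))\<^sup>2)"
  have "(\<integral>\<^sup>+z. indicator {..<Suc n} (arr z t) * ennreal ((load z t)\<^sup>2) \<partial>input) =
     (\<integral>\<^sup>+a. \<integral>\<^sup>+s. \<integral>\<^sup>+z. indicator {..t} a * (indicator {..<n} (arr z (t - a)) *
        (ennreal (s\<^sup>2) + ennreal (2 * s) * ennreal (load z (t - a)) + ennreal ((load z (t - a))\<^sup>2)))
      \<partial>input \<partial>G \<partial>expo)"
  proof (rule nn_integral_input_iterate_regular)
    fix a s z assume as: "0 < (a::real)" "0 < (s::real)" "regular z"
    have "(s + load z (t - a))\<^sup>2 = s\<^sup>2 + 2 * s * load z (t - a) + (load z (t - a))\<^sup>2"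
      by (simp add: power2_eq_square algebra_simps)
    then have "ennreal ((s + load z (t - a))\<^sup>2) =
        ennreal (s\<^sup>2) + ennreal (2 * s) * ennreal (load z (t - a)) + ennreal ((load z (t - a))\<^sup>2)"
      using as load_nonneg[of z "t - a"] by (simp add: ennreal_mult[symmetric])
    with as show "indicator {..<Suc n} (arr (case_nat (a, s) z) t) * ennreal ((load (case_nat (a, s) z) t)\<^sup>2) =
        indicator {..t} a * (indicator {..<n} (arr z (t - a)) *
        (ennreal (s\<^sup>2) + ennreal (2 * s) * ennreal (load z (t - a)) + ennreal ((load z (t - a))\<^sup>2)))"
      by (cases "a \<le> t")
         (simp_all add: regular_case_nat arr_tail load_after load_before indicator_def)
  qed measurable
  also have "\<dots> \<le> (\<integral>\<^sup>+a. \<integral>\<^sup>+s. indicator {..t} a *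
     (ennreal (s\<^sup>2) + ennreal (2 * (r * T * m)) * ennreal s + ennreal (r * (t - a) * K)) \<partial>G \<partial>expo)"
  proof (intro nn_integral_mono_AE)
    have "(\<integral>\<^sup>+z. indicator {..t} a * (indicator {..<n} (arr z (t - a)) *
        (ennreal (s\<^sup>2) + ennreal (2 * s) * ennreal (load z (t - a)) + ennreal ((load z (t - a))\<^sup>2))) \<partial>input)
      \<le> indicator {..t} a * (ennreal (s\<^sup>2) + ennreal (2 * (r * T * m)) * ennreal s + ennreal (r * (t - a) * K))"
      if "0 < a" "0 < s" for a s
    proof (cases "a \<le> t")
      case True
      have "(\<integral>\<^sup>+z. indicator {..<n} (arr z (t - a)) *
        (ennreal (s\<^sup>2) + ennreal (2 * s) * ennreal (load z (t - a)) + ennreal ((load z (t - a))\<^sup>2)) \<partial>input) \<le>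
        (\<integral>\<^sup>+z. ennreal (s\<^sup>2) + ennreal (2 * s) * ?L a z + ?Q a z \<partial>input)"
        by (intro nn_integral_mono) (auto simp: indicator_def)
      also have "\<dots> = ennreal (s\<^sup>2) + ennreal (2 * s) * (\<integral>\<^sup>+z. ?L a z \<partial>input) + (\<integral>\<^sup>+z. ?Q a z \<partial>input)"
        using input.emeasure_space_1 by (simp add: nn_integral_add nn_integral_cmult)
      also have "\<dots> \<le> ennreal (s\<^sup>2) + ennreal (2 * s) * ennreal (r * T * m) + ennreal (r * (t - a) * K)"
      proof (intro add_mono mult_left_mono order_refl)
        have "(\<integral>\<^sup>+z. ?L a z \<partial>input) \<le> ennreal (r * (t - a) * m)"
          using True by (intro nn_integral_load_truncated) simp
        also have "\<dots> \<le> ennreal (r * T * m)"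
          using True Suc.prems rate_pos m that by (intro ennreal_leI mult_right_mono mult_left_mono) auto
        finally show "(\<integral>\<^sup>+z. ?L a z \<partial>input) \<le> ennreal (r * T * m)" .
        show "(\<integral>\<^sup>+z. ?Q a z \<partial>input) \<le> ennreal (r * (t - a) * K)"
          unfolding K_def using True Suc.prems that by (intro Suc.IH) auto
      qed simp
      also have "ennreal (2 * s) * ennreal (r * T * m) = ennreal (2 * (r * T * m)) * ennreal s"
        using that rate_pos m Suc.prems by (simp add: ennreal_mult[symmetric] mult_ac)
      finally show ?thesis using True by simp
    qed simp
    then show "AE a in expo. (\<integral>\<^sup>+s. \<integral>\<^sup>+z. indicator {..t} a * (indicator {..<n} (arr z (t - a)) *
        (ennreal (s\<^sup>2) + ennreal (2 * s) * ennreal (load z (t - a)) + ennreal ((load z (t - a))\<^sup>2))) \<partial>input \<partial>G)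
      \<le> (\<integral>\<^sup>+s. indicator {..t} a * (ennreal (s\<^sup>2) + ennreal (2 * (r * T * m)) * ennreal s + ennreal (r * (t - a) * K)) \<partial>G)"
      using AE_expo_pos service_pos
      by (auto elim!: eventually_mono intro!: nn_integral_mono_AE)
  qed
  also have "\<dots> \<le> (\<integral>\<^sup>+a. ennreal K * (indicator {..t} a * ennreal (1 + r * (t - a))) \<partial>expo)"
  proof (intro nn_integral_mono)
    fix a
    show "(\<integral>\<^sup>+s. indicator {..t} a * (ennreal (s\<^sup>2) + ennreal (2 * (r * T * m)) * ennreal s + ennreal (r * (t - a) * K)) \<partial>G)
      \<le> ennreal K * (indicator {..t} a * ennreal (1 + r * (t - a)))"
    proof (cases "a \<le> t")
      case True
      have "(\<integral>\<^sup>+s. ennreal (s\<^sup>2) + ennreal (2 * (r * T * m)) * ennreal s + ennreal (r * (t - a) * K) \<partial>G) =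
         (\<integral>\<^sup>+s. ennreal (s\<^sup>2) \<partial>G) + ennreal (2 * (r * T * m)) * (\<integral>\<^sup>+s. ennreal s \<partial>G) + ennreal (r * (t - a) * K)"
        using G.emeasure_space_1 by (simp add: nn_integral_add nn_integral_cmult)
      also have "\<dots> \<le> ennreal q + ennreal (2 * (r * T * m)) * ennreal m + ennreal (r * (t - a) * K)"
        using mean_le square_le by (intro add_mono mult_left_mono) auto
      also have "\<dots> = ennreal (q + 2 * (r * T * m) * m + r * (t - a) * K)"
        using m q K True rate_pos Suc.prems by (simp add: ennreal_mult[symmetric])
      also have "q + 2 * (r * T * m) * m + r * (t - a) * K = K * (1 + r * (t - a))"
        by (simp add: K_def algebra_simps)
      also have "ennreal \<dots> = ennreal K * ennreal (1 + r * (t - a))"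
        using K True rate_pos by (intro ennreal_mult) auto
      finally show ?thesis using True by simp
    qed simp
  qed
  also have "\<dots> = ennreal K * (\<integral>\<^sup>+a. indicator {..t} a * ennreal (1 + r * (t - a)) \<partial>expo)"
    by (rule nn_integral_cmult) measurable
  also have "\<dots> = ennreal (r * t * K)"
    using Suc.prems K rate_pos by (simp add: expo_renewal ennreal_mult[symmetric] mult_ac)
  finally show ?case unfolding K_def .
qed (simp add: indicator_def)

lemma nn_integral_load_square:
  assumes "0 \<le> q" "(\<integral>\<^sup>+s. ennreal (s\<^sup>2) \<partial>G) \<le> ennreal q" "0 \<le> t"
  shows "(\<integral>\<^sup>+z. ennreal ((load z t)\<^sup>2) \<partial>input) \<le> ennreal (r * t * (q + 2 * m * (r * t * m)))"
proof (rule nn_integral_le_truncated)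
  show "(\<lambda>z. ennreal ((load z t)\<^sup>2)) \<in> borel_measurable input_space" by measurable
qed (rule nn_integral_load_square_truncated[OF assms order_refl])

end

end

context mg1_input
begin

section \<open>The Markov property of a family of independent queues\<close>

text \<open>The time \<open>t\<close> is common to all queues, so their inputs can be renewed one
  coordinate at a time. Fubini then brings the fresh input of queue \<open>i\<close> together with
  those of \<open>I\<close>.\<close>

theorem markov_PiM:
  assumes "finite I"
    and "F \<in> borel_measurable (PiM I (\<lambda>_. borel) \<Otimes>\<^sub>M PiM I (\<lambda>_. input))" and t: "0 \<le> t"
  shows "(\<integral>\<^sup>+\<iota>. F (\<lambda>i\<in>I. workload (w i) (\<iota> i) t, \<lambda>i\<in>I. shift_input t (\<iota> i)) \<partial>PiM I (\<lambda>_. input)) =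
    (\<integral>\<^sup>+\<iota>. \<integral>\<^sup>+\<iota>'. F (\<lambda>i\<in>I. workload (w i) (\<iota> i) t, \<iota>') \<partial>PiM I (\<lambda>_. input) \<partial>PiM I (\<lambda>_. input))"
  using assms(1,2)
proof (induction I arbitrary: F)
  case empty
  interpret product_sigma_finite "\<lambda>_::'a. input" ..
  show ?case by (simp add: nn_integral_empty restrict_def)
next
  case (insert i I)
  note F [measurable] = insert.prems
  interpret product_sigma_finite "\<lambda>_::'a. input" ..
  interpret I: prob_space "PiM I (\<lambda>_. input)"
    by (intro prob_space_PiM input.prob_space_axioms)
  interpret pair_sigma_finite "PiM I (\<lambda>_. input)" input ..
  have [measurable]: "(\<lambda>x. (f x)(i := g x)) \<in> N \<rightarrow>\<^sub>M PiM (insert i I) (\<lambda>_. K)"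
    if "f \<in> N \<rightarrow>\<^sub>M PiM I (\<lambda>_. K)" "g \<in> N \<rightarrow>\<^sub>M K" for f g N and K :: "'z measure"
    using that by (intro measurable_fun_upd[where J = I]) auto
  define W where "W x = (\<lambda>j\<in>I. workload (w j) (x j) t)" for x
  define V where "V x = (\<lambda>j\<in>I. shift_input t (x j))" for x
  have [measurable]: "W \<in> PiM I (\<lambda>_. input) \<rightarrow>\<^sub>M PiM I (\<lambda>_. borel)"
    unfolding W_def by measurable
  have [measurable]: "V \<in> PiM I (\<lambda>_. input) \<rightarrow>\<^sub>M PiM I (\<lambda>_. input)"
    unfolding V_def by measurable
  have upd: "(\<lambda>j\<in>insert i I. workload (w j) ((x(i := y)) j) t) = (W x)(i := workload (w i) y t)"
    "(\<lambda>j\<in>insert i I. shift_input t ((x(i := y)) j)) = (V x)(i := shift_input t y)" for x y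
    using insert.hyps by (auto simp: W_def V_def restrict_def fun_eq_iff)
  have Ms [measurable]: "(\<lambda>x. \<lambda>j\<in>insert i I. workload (w j) (x j) t) \<in> PiM (insert i I) (\<lambda>_. input) \<rightarrow>\<^sub>M PiM (insert i I) (\<lambda>_. borel)"
    "(\<lambda>x. \<lambda>j\<in>insert i I. shift_input t (x j)) \<in> PiM (insert i I) (\<lambda>_. input) \<rightarrow>\<^sub>M PiM (insert i I) (\<lambda>_. input)"
    by measurable
  \<comment> \<open>In \<open>H\<close> the input of queue \<open>i\<close> is already renewed; the
    induction hypothesis for \<open>I\<close> is applied to this function.\<close>
  define H where "H p = (\<integral>\<^sup>+y. \<integral>\<^sup>+y'. F ((fst p)(i := workload (w i) y t), (snd p)(i := y')) \<partial>input \<partial>input)" for p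
  have H [measurable]: "H \<in> borel_measurable (PiM I (\<lambda>_. borel) \<Otimes>\<^sub>M PiM I (\<lambda>_. input))"
    unfolding H_def by measurable
  have "(\<integral>\<^sup>+\<iota>. F (\<lambda>j\<in>insert i I. workload (w j) (\<iota> j) t, \<lambda>j\<in>insert i I. shift_input t (\<iota> j)) \<partial>PiM (insert i I) (\<lambda>_. input)) =
    (\<integral>\<^sup>+x. \<integral>\<^sup>+y. F ((W x)(i := workload (w i) y t), (V x)(i := shift_input t y)) \<partial>input \<partial>PiM I (\<lambda>_. input))"
    unfolding upd[symmetric]
    by (rule product_nn_integral_insert) (use insert.hyps in \<open>auto\<close>)
  also have "\<dots> = (\<integral>\<^sup>+x. H (W x, V x) \<partial>PiM I (\<lambda>_. input))"
  proof (rule nn_integral_cong)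
    fix x assume x: "x \<in> space (PiM I (\<lambda>_. input))"
    then have [simp]: "W x \<in> space (PiM I (\<lambda>_. borel))" "V x \<in> space (PiM I (\<lambda>_. input))"
      by (auto simp: W_def V_def space_PiM)
    have "(\<lambda>(a, b). F ((W x)(i := a), (V x)(i := b))) \<in> borel_measurable (borel \<Otimes>\<^sub>M input)"
      by measurable
    then have "(\<lambda>(a, b). F ((W x)(i := a), (V x)(i := b))) \<in> borel_measurable (borel \<Otimes>\<^sub>M input_space)"
      by (subst measurable_cong_sets[OF sets_pair_measure_cong[OF refl sets_input[symmetric]] refl])
    from markov[OF this t, of "w i"] show "(\<integral>\<^sup>+y. F ((W x)(i := workload (w i) y t), (V x)(i := shift_input t y)) \<partial>input) = H (W x, V x)"
      by (simp add: H_def)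
  qed
  also have "\<dots> = (\<integral>\<^sup>+x. \<integral>\<^sup>+x'. H (W x, x') \<partial>PiM I (\<lambda>_. input) \<partial>PiM I (\<lambda>_. input))"
    unfolding W_def V_def by (rule insert.IH[OF H])
  also have "\<dots> = (\<integral>\<^sup>+x. \<integral>\<^sup>+y. \<integral>\<^sup>+x'. \<integral>\<^sup>+y'. F ((W x)(i := workload (w i) y t), x'(i := y')) \<partial>input
       \<partial>PiM I (\<lambda>_. input) \<partial>input \<partial>PiM I (\<lambda>_. input))"
  proof (rule nn_integral_cong)
    fix x assume x: "x \<in> space (PiM I (\<lambda>_. input))"
    then have [simp]: "W x \<in> space (PiM I (\<lambda>_. borel))" by (auto simp: W_def space_PiM)
    have "(\<lambda>(x', y). \<integral>\<^sup>+y'. F ((W x)(i := workload (w i) y t), x'(i := y')) \<partial>input)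
       \<in> borel_measurable (PiM I (\<lambda>_. input) \<Otimes>\<^sub>M input)"
      by measurable
    from Fubini'[OF this] show "(\<integral>\<^sup>+x'. H (W x, x') \<partial>PiM I (\<lambda>_. input)) =
        (\<integral>\<^sup>+y. \<integral>\<^sup>+x'. \<integral>\<^sup>+y'. F ((W x)(i := workload (w i) y t), x'(i := y')) \<partial>input \<partial>PiM I (\<lambda>_. input) \<partial>input)"
      by (simp add: H_def)
  qed
  also have "\<dots> = (\<integral>\<^sup>+x. \<integral>\<^sup>+y. \<integral>\<^sup>+\<iota>'. F ((W x)(i := workload (w i) y t), \<iota>') \<partial>PiM (insert i I) (\<lambda>_. input)
       \<partial>input \<partial>PiM I (\<lambda>_. input))"
  proof (intro nn_integral_cong)
    fix x y assume x: "x \<in> space (PiM I (\<lambda>_. input))"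
    then have [simp]: "W x \<in> space (PiM I (\<lambda>_. borel))" by (auto simp: W_def space_PiM)
    have "(\<lambda>\<iota>'. F ((W x)(i := workload (w i) y t), \<iota>')) \<in> borel_measurable (PiM (insert i I) (\<lambda>_. input))"
      by measurable
    from product_nn_integral_insert[OF insert.hyps this]
    show "(\<integral>\<^sup>+x'. \<integral>\<^sup>+y'. F ((W x)(i := workload (w i) y t), x'(i := y')) \<partial>input \<partial>PiM I (\<lambda>_. input)) =
      (\<integral>\<^sup>+\<iota>'. F ((W x)(i := workload (w i) y t), \<iota>') \<partial>PiM (insert i I) (\<lambda>_. input))" by simp
  qed
  also have "\<dots> = (\<integral>\<^sup>+\<iota>. \<integral>\<^sup>+\<iota>'. F (\<lambda>j\<in>insert i I. workload (w j) (\<iota> j) t, \<iota>') \<partial>PiM (insert i I) (\<lambda>_. input) \<partial>PiM (insert i I) (\<lambda>_. input))"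
    unfolding upd(1)[symmetric]
  proof (rule product_nn_integral_insert[symmetric])
    interpret J: prob_space "PiM (insert i I) (\<lambda>_. input)"
      by (intro prob_space_PiM input.prob_space_axioms)
    show "(\<lambda>\<iota>. \<integral>\<^sup>+\<iota>'. F (\<lambda>j\<in>insert i I. workload (w j) (\<iota> j) t, \<iota>') \<partial>PiM (insert i I) (\<lambda>_. input))
      \<in> borel_measurable (PiM (insert i I) (\<lambda>_. input))"
      by measurable
  qed (use insert.hyps in auto)
  finally show ?case .
qed

lemma nn_integral_PiM_component:
  assumes "i \<in> I" and [measurable]: "f \<in> borel_measurable input_space"
  shows "(\<integral>\<^sup>+\<iota>. f (\<iota> i) \<partial>PiM I (\<lambda>_. input)) = (\<integral>\<^sup>+z. f z \<partial>input)"
proof -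
  have "(\<integral>\<^sup>+z. f z \<partial>input) = (\<integral>\<^sup>+z. f z \<partial>distr (PiM I (\<lambda>_. input)) input (\<lambda>\<iota>. \<iota> i))"
    using assms by (subst distr_PiM_component) (auto intro: input.prob_space_axioms)
  also have "\<dots> = (\<integral>\<^sup>+\<iota>. f (\<iota> i) \<partial>PiM I (\<lambda>_. input))"
    using assms(1) by (intro nn_integral_distr) measurable
  finally show ?thesis ..
qed

section \<open>Second moments and stationarity\<close>

context
  fixes m q :: real
  assumes m: "0 \<le> m" and mean_le: "(\<integral>\<^sup>+s. ennreal s \<partial>G) \<le> ennreal m" and stable: "r * m < 1"
    and q: "0 \<le> q" and square_le: "(\<integral>\<^sup>+s. ennreal (s\<^sup>2) \<partial>G) \<le> ennreal q"
begin

definition drift :: real where "drift = 1 - r * m"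

text \<open>The first summand bounds the second moment of the work arriving in unit time. The
  \<open>2\<close> covers the \<open>1\<close> in \<open>(w - 1)\<^sup>2\<close> when
  \<open>1 <= w\<close>, and \<open>2 * drift * w\<close> when \<open>w < 1\<close> and nothing of
  \<open>w\<close> is left.\<close>

definition spread :: real where "spread = r * (q + 2 * m * (r * m)) + 2"

lemma drift_pos: "0 < drift" and drift_le_1: "drift \<le> 1"
  using stable m rate_pos by (auto simp: drift_def)

lemma spread_ge_2: "2 \<le> spread"
  using m q rate_pos by (simp add: spread_def)

text \<open>Completing the square. The sign matters since \<open>ennreal\<close> turns negative
  numbers into 0, and sums of bounds would no longer agree with real sums.\<close>

lemma drift_spread_nonneg: "0 \<le> w\<^sup>2 - 2 * drift * w + spread"
proof -
  have "drift * drift \<le> 1" using drift_pos drift_le_1 by (simp add: mult_le_one)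
  moreover have "w\<^sup>2 - 2 * drift * w + spread = (w - drift)\<^sup>2 + (spread - drift * drift)"
    by (simp add: power2_eq_square algebra_simps)
  ultimately show ?thesis using spread_ge_2 zero_le_power2[of "w - drift"] by linarith
qed

text \<open>In the square of \<open>v + load z 1\<close>, passing from \<open>w\<close> to
  \<open>v\<close> gains about \<open>2 * w\<close> and the cross term gives back at most
  \<open>2 * v * (r * m)\<close>; the difference is the term \<open>2 * drift * w\<close>.\<close>

lemma nn_integral_workload_square:
  assumes w: "0 \<le> w"
  shows "(\<integral>\<^sup>+z. ennreal ((workload w z 1)\<^sup>2) \<partial>input) \<le> ennreal (w\<^sup>2 - 2 * drift * w + spread)"
proof -
  define v where "v = max 0 (w - 1)"
  have v: "0 \<le> v" by (simp add: v_def)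
  have "(\<integral>\<^sup>+z. ennreal ((workload w z 1)\<^sup>2) \<partial>input) \<le>
    (\<integral>\<^sup>+z. ennreal (v\<^sup>2) + ennreal (2 * v) * ennreal (load z 1) + ennreal ((load z 1)\<^sup>2) \<partial>input)"
  proof (rule nn_integral_mono_AE)
    show "AE z in input. ennreal ((workload w z 1)\<^sup>2) \<le>
        ennreal (v\<^sup>2) + ennreal (2 * v) * ennreal (load z 1) + ennreal ((load z 1)\<^sup>2)"
      using AE_regular
    proof eventually_elim
      case (elim z)
      have "(workload w z 1)\<^sup>2 \<le> (v + load z 1)\<^sup>2"
        using workload_le_load[OF elim, of 1 w] workload_nonneg[of w z 1]
        by (intro power_mono) (auto simp: v_def)
      also have "\<dots> = v\<^sup>2 + 2 * v * load z 1 + (load z 1)\<^sup>2"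
        by (simp add: power2_eq_square algebra_simps)
      finally show ?case
        using v load_nonneg[OF elim, of 1] by (simp add: ennreal_mult[symmetric] ennreal_plus[symmetric] del: ennreal_plus)
    qed
  qed
  also have "\<dots> = ennreal (v\<^sup>2) + ennreal (2 * v) * (\<integral>\<^sup>+z. ennreal (load z 1) \<partial>input) + (\<integral>\<^sup>+z. ennreal ((load z 1)\<^sup>2) \<partial>input)"
    using input.emeasure_space_1 by (simp add: nn_integral_add nn_integral_cmult)
  also have "\<dots> \<le> ennreal (v\<^sup>2) + ennreal (2 * v) * ennreal (r * m) + ennreal (r * (q + 2 * m * (r * m)))"
    using nn_integral_load[OF m mean_le, of 1] nn_integral_load_square[OF m mean_le q square_le, of 1]
    by (intro add_mono mult_left_mono) auto
  also have "\<dots> = ennreal (v\<^sup>2 + 2 * v * (r * m) + r * (q + 2 * m * (r * m)))"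
    using v m q rate_pos by (simp add: ennreal_mult[symmetric])
  also have "\<dots> \<le> ennreal (w\<^sup>2 - 2 * drift * w + spread)"
  proof (rule ennreal_leI)
    show "v\<^sup>2 + 2 * v * (r * m) + r * (q + 2 * m * (r * m)) \<le> w\<^sup>2 - 2 * drift * w + spread"
    proof (cases "1 \<le> w")
      case True
      have "0 \<le> r * m" using m rate_pos by simp
      then show ?thesis using True by (simp add: v_def drift_def spread_def power2_eq_square algebra_simps)
    next
      case False
      have "w * drift \<le> 1" using False w drift_pos drift_le_1 by (intro mult_le_one) auto
      then show ?thesis using False by (simp add: v_def spread_def mult_ac)
    qed
  qed
  finally show ?thesis .
qed

text \<open>Stationarity is tested on the square capped at level \<open>k\<close>. Where
  \<open>w <= k\<close>, the drift inequality applies to the capped function; beyond, it has its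
  maximal value and cannot increase. The resulting bound by \<open>spread\<close> is uniform in
  \<open>k\<close>.\<close>

lemma stationary_mean_finite:
  assumes "prob_space \<mu>" and sets [measurable_cong]: "sets \<mu> = sets borel" and pos: "AE w in \<mu>. 0 \<le> w"
    and stat: "\<And>f. f \<in> borel_measurable borel \<Longrightarrow>
       (\<integral>\<^sup>+w. \<integral>\<^sup>+z. f (workload w z 1) \<partial>input \<partial>\<mu>) = (\<integral>\<^sup>+w. f w \<partial>\<mu>)"
  shows "(\<integral>\<^sup>+w. ennreal w \<partial>\<mu>) < \<infinity>"
proof -
  interpret \<mu>: prob_space \<mu> by fact
  have le: "(\<integral>\<^sup>+w. ennreal (2 * drift * w) * indicator {..real k} w \<partial>\<mu>) \<le> ennreal spread" for k
  proof -
    define g where "g = (\<lambda>w::real. ennreal (min (w\<^sup>2) ((real k)\<^sup>2)))"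
    have [measurable]: "g \<in> borel_measurable borel" unfolding g_def by measurable
    have gk: "g w \<le> ennreal ((real k)\<^sup>2)" for w unfolding g_def by (rule ennreal_leI) simp
    have bd: "(\<integral>\<^sup>+w. g w \<partial>\<mu>) \<le> ennreal ((real k)\<^sup>2)"
      using nn_integral_mono[of \<mu> g "\<lambda>_. ennreal ((real k)\<^sup>2)"] gk \<mu>.emeasure_space_1 by simp
    have "(\<integral>\<^sup>+w. ennreal (2 * drift * w) * indicator {..real k} w \<partial>\<mu>) + (\<integral>\<^sup>+w. g w \<partial>\<mu>) =
      (\<integral>\<^sup>+w. ennreal (2 * drift * w) * indicator {..real k} w + (\<integral>\<^sup>+z. g (workload w z 1) \<partial>input) \<partial>\<mu>)"
      by (subst stat[symmetric], measurable, subst nn_integral_add) measurable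
    also have "\<dots> \<le> (\<integral>\<^sup>+w. g w + ennreal spread \<partial>\<mu>)"
    proof (rule nn_integral_mono_AE)
      show "AE w in \<mu>. ennreal (2 * drift * w) * indicator {..real k} w + (\<integral>\<^sup>+z. g (workload w z 1) \<partial>input)
          \<le> g w + ennreal spread"
        using pos
      proof eventually_elim
        case (elim w)
        have "(\<integral>\<^sup>+z. g (workload w z 1) \<partial>input) \<le> (\<integral>\<^sup>+z. ennreal ((real k)\<^sup>2) \<partial>input)"
          by (intro nn_integral_mono gk)
        then have 1: "(\<integral>\<^sup>+z. g (workload w z 1) \<partial>input) \<le> ennreal ((real k)\<^sup>2)"
          using input.emeasure_space_1 by simp
        have "(\<integral>\<^sup>+z. g (workload w z 1) \<partial>input) \<le> (\<integral>\<^sup>+z. ennreal ((workload w z 1)\<^sup>2) \<partial>input)"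
          unfolding g_def by (intro nn_integral_mono ennreal_leI) simp
        also have "\<dots> \<le> ennreal (w\<^sup>2 - 2 * drift * w + spread)"
          by (rule nn_integral_workload_square) fact
        finally have 2: "(\<integral>\<^sup>+z. g (workload w z 1) \<partial>input) \<le> ennreal (w\<^sup>2 - 2 * drift * w + spread)" .
        show ?case
        proof (cases "w \<le> real k")
          case True
          have "ennreal (2 * drift * w) + (\<integral>\<^sup>+z. g (workload w z 1) \<partial>input) \<le>
             ennreal (2 * drift * w) + ennreal (w\<^sup>2 - 2 * drift * w + spread)"
            using 2 by (rule add_left_mono)
          also have "\<dots> = ennreal (w\<^sup>2 + spread)"
            using drift_spread_nonneg[of w] drift_pos elim by (subst ennreal_plus[symmetric]) auto
          also have "\<dots> = g w + ennreal spread"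
            using True elim spread_ge_2 by (simp add: g_def min_absorb1 power_mono)
          finally show ?thesis using True by simp
        next
          case False
          then have "g w = ennreal ((real k)\<^sup>2)" by (simp add: g_def min_absorb2 power_mono)
          then show ?thesis using False 1 by (auto intro: order_trans add_increasing2)
        qed
      qed
    qed
    also have "\<dots> = ennreal spread + (\<integral>\<^sup>+w. g w \<partial>\<mu>)"
      using \<mu>.emeasure_space_1 by (subst nn_integral_add) (auto simp: add.commute)
    \<comment> \<open>The integral of \<open>g\<close> occurs on both sides and is finite by
      \<open>bd\<close>, so it cancels.\<close>
    finally show ?thesis
      using bd by (subst (asm) add.commute, subst (asm) (2) add.commute)
        (auto simp: ennreal_add_left_cancel_le top_unique)
  qed
  have "(\<integral>\<^sup>+w. ennreal (2 * drift * w) \<partial>\<mu>) = (\<integral>\<^sup>+w. (SUP k::nat. ennreal (2 * drift * w) * indicator {..real k} w) \<partial>\<mu>)"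
  proof (rule nn_integral_cong)
    fix w
    obtain k :: nat where "w \<le> real k" using real_arch_simple by blast
    then show "ennreal (2 * drift * w) = (SUP k::nat. ennreal (2 * drift * w) * indicator {..real k} w)"
      by (intro antisym SUP_upper2[of k] SUP_least) (auto simp: indicator_def)
  qed
  also have "\<dots> = (SUP k::nat. \<integral>\<^sup>+w. ennreal (2 * drift * w) * indicator {..real k} w \<partial>\<mu>)"
    by (intro nn_integral_monotone_convergence_SUP) (auto simp: incseq_def le_fun_def indicator_def)
  also have "\<dots> \<le> ennreal spread" using le by (intro SUP_least) auto
  finally have *: "(\<integral>\<^sup>+w. ennreal (2 * drift * w) \<partial>\<mu>) \<le> ennreal spread" .
  have "(\<integral>\<^sup>+w. ennreal (2 * drift * w) \<partial>\<mu>) = ennreal (2 * drift) * (\<integral>\<^sup>+w. ennreal w \<partial>\<mu>)"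
    using drift_pos by (subst nn_integral_cmult[symmetric]) (auto simp: ennreal_mult')
  with * have "ennreal (2 * drift) * (\<integral>\<^sup>+w. ennreal w \<partial>\<mu>) < \<infinity>"
    by (simp add: le_less_trans)
  then show ?thesis using drift_pos by (auto simp: ennreal_mult_less_top)
qed

end

section \<open>A finite stationary mean forces a finite second moment of the service\<close>

lemma emeasure_first_arrival_after:
  assumes "0 \<le> t"
  shows "emeasure input {z. t < fst (z 0)} = ennreal (exp (- r * t))"
proof -
  have [measurable]: "{z. t < fst (z 0)} \<in> sets input_space"
  proof -
    have "{z \<in> space input_space. t < fst (z 0)} \<in> sets input_space" by measurable
    then show ?thesis by (simp add: space_PiM space_pair_measure)
  qed
  have "emeasure input {z. t < fst (z 0)} = (\<integral>\<^sup>+z. indicator {z. t < fst (z 0)} z \<partial>input)"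
    by (rule nn_integral_indicator[symmetric]) measurable
  also have "\<dots> = (\<integral>\<^sup>+a. \<integral>\<^sup>+s. \<integral>\<^sup>+z. indicator {t<..} a \<partial>input \<partial>G \<partial>expo)"
    by (rule nn_integral_input_iterate_regular) (auto simp: indicator_def)
  also have "\<dots> = ennreal (exp (- r * t))"
    using G.emeasure_space_1 input.emeasure_space_1 assms
    by (simp add: emeasure_expo_greater)
  finally show ?thesis .
qed

text \<open>The test function is the square of \<open>w\<close> capped at \<open>2 * k\<close>. In
  unit time it loses at most \<open>2 * w\<close>, and a first arrival adds the square of the
  service beyond 1. With \<open>w <= k\<close> and that service capped at \<open>k\<close>, their
  sum stays below the cap \<open>2 * k\<close>, so the gain is not cut off. In equilibrium the mean
  gain cannot exceed the mean loss.\<close>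

lemma stationary_mean_imp_square_finite:
  assumes "prob_space \<mu>" and sets [measurable_cong]: "sets \<mu> = sets borel" and pos: "AE w in \<mu>. 0 \<le> w"
    and stat: "\<And>f. f \<in> borel_measurable borel \<Longrightarrow>
       (\<integral>\<^sup>+w. \<integral>\<^sup>+z. f (workload w z 1) \<partial>input \<partial>\<mu>) = (\<integral>\<^sup>+w. f w \<partial>\<mu>)"
    and mean: "(\<integral>\<^sup>+w. ennreal w \<partial>\<mu>) < \<infinity>"
  shows "(\<integral>\<^sup>+s. ennreal (s\<^sup>2) \<partial>G) < \<infinity>"
proof -
  interpret \<mu>: prob_space \<mu> by fact
  \<comment> \<open>Only the part of a service beyond 1 is sure to count in the workload at time
    1.\<close>
  define h where "h k s = ennreal ((min (real k) (max 0 (s - 1)))\<^sup>2)" for k :: nat and s :: real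
  have [measurable]: "h k \<in> borel_measurable borel" for k unfolding h_def by measurable
  have le: "(\<integral>\<^sup>+w. indicator {..real k} w * (\<integral>\<^sup>+z. indicator {..1} (fst (z 0)) * h k (snd (z 0)) \<partial>input) \<partial>\<mu>)
      \<le> (\<integral>\<^sup>+w. ennreal (2 * w) \<partial>\<mu>)" for k
  proof -
    define g where "g = (\<lambda>w::real. ennreal ((min w (2 * real k))\<^sup>2))"
    have [measurable]: "g \<in> borel_measurable borel" unfolding g_def by measurable
    have "(\<integral>\<^sup>+w. g w \<partial>\<mu>) \<le> (\<integral>\<^sup>+w. ennreal ((2 * real k)\<^sup>2) \<partial>\<mu>)"
      using pos unfolding g_def
      by (intro nn_integral_mono_AE, eventually_elim) (intro ennreal_leI power_mono, auto)
    then have bd: "(\<integral>\<^sup>+w. g w \<partial>\<mu>) \<le> ennreal ((2 * real k)\<^sup>2)" using \<mu>.emeasure_space_1 by simp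
    have "(\<integral>\<^sup>+w. g w \<partial>\<mu>) + (\<integral>\<^sup>+w. indicator {..real k} w * (\<integral>\<^sup>+z. indicator {..1} (fst (z 0)) * h k (snd (z 0)) \<partial>input) \<partial>\<mu>)
      = (\<integral>\<^sup>+w. \<integral>\<^sup>+z. g w + indicator {..real k} w * (indicator {..1} (fst (z 0)) * h k (snd (z 0))) \<partial>input \<partial>\<mu>)"
      using input.emeasure_space_1
      by (simp add: nn_integral_add nn_integral_cmult)
    also have "\<dots> \<le> (\<integral>\<^sup>+w. \<integral>\<^sup>+z. g (workload w z 1) + ennreal (2 * w) \<partial>input \<partial>\<mu>)"
    proof (rule nn_integral_mono_AE)
      show "AE w in \<mu>. (\<integral>\<^sup>+z. g w + indicator {..real k} w * (indicator {..1} (fst (z 0)) * h k (snd (z 0))) \<partial>input) \<le>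
        (\<integral>\<^sup>+z. g (workload w z 1) + ennreal (2 * w) \<partial>input)"
        using pos
      proof eventually_elim
        case w: (elim w)
        show ?case
        proof (rule nn_integral_mono_AE)
          show "AE z in input. g w + indicator {..real k} w * (indicator {..1} (fst (z 0)) * h k (snd (z 0))) \<le>
             g (workload w z 1) + ennreal (2 * w)"
            using AE_regular
          proof eventually_elim
            case (elim z)
            define v where "v = max 0 (w - 1)"
            define s where "s = min (real k) (max 0 (snd (z 0) - 1))"
            have v: "0 \<le> v" "v \<le> workload w z 1"
              using workload_ge_drain[OF elim, of 1 w] workload_nonneg[of w z 1] by (auto simp: v_def)
            have s: "0 \<le> s" "s \<le> real k" by (auto simp: s_def)
            \<comment> \<open>Capping is 1-Lipschitz, so the capped workload loses at most 1; the
              factor \<open>x + y\<close> is at most \<open>2 * w\<close>.\<close>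
            have gw: "(min w (2 * real k))\<^sup>2 \<le> (min v (2 * real k))\<^sup>2 + 2 * w"
            proof -
              define x y where "x = min w (2 * real k)" and "y = min v (2 * real k)"
              have xy: "0 \<le> x" "0 \<le> y" "x \<le> w" "y \<le> w" "x \<le> y + 1" using w by (auto simp: x_def y_def v_def)
              have "x\<^sup>2 - y\<^sup>2 = (x - y) * (x + y)" by (simp add: power2_eq_square algebra_simps)
              also have "\<dots> \<le> 1 * (x + y)" using xy by (intro mult_right_mono) auto
              finally show ?thesis using xy by (simp add: x_def y_def)
            qed
            show ?case
            proof (cases "w \<le> real k \<and> fst (z 0) \<le> 1")
              case True
              have "v + s \<le> workload w z 1"
                using workload_ge_first_arrival[OF elim, of 1 w] True w by (auto simp: v_def s_def)
              moreover have "v \<le> real k" using True by (auto simp: v_def)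
              ultimately have "(v + s)\<^sup>2 \<le> (min (workload w z 1) (2 * real k))\<^sup>2"
                using v s by (intro power_mono) auto
              moreover have "v\<^sup>2 + s\<^sup>2 \<le> (v + s)\<^sup>2" using v s by (simp add: power2_eq_square algebra_simps)
              moreover have "min v (2 * real k) = v" using \<open>v \<le> real k\<close> by simp
              ultimately have "(min w (2 * real k))\<^sup>2 + s\<^sup>2 \<le> (min (workload w z 1) (2 * real k))\<^sup>2 + 2 * w"
                using gw by simp
              then show ?thesis using True w
                by (simp add: g_def h_def s_def[symmetric] ennreal_plus[symmetric] del: ennreal_plus)
            next
              case False
              have "(min v (2 * real k))\<^sup>2 \<le> (min (workload w z 1) (2 * real k))\<^sup>2"
                using v by (intro power_mono) auto
              then have "(min w (2 * real k))\<^sup>2 \<le> (min (workload w z 1) (2 * real k))\<^sup>2 + 2 * w"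
                using gw by simp
              then show ?thesis using False w
                by (auto simp: g_def ennreal_plus[symmetric] simp del: ennreal_plus)
            qed
          qed
        qed
      qed
    qed
    also have "\<dots> = (\<integral>\<^sup>+w. (\<integral>\<^sup>+z. g (workload w z 1) \<partial>input) + ennreal (2 * w) \<partial>\<mu>)"
      using input.emeasure_space_1 by (simp add: nn_integral_add)
    also have "\<dots> = (\<integral>\<^sup>+w. g w \<partial>\<mu>) + (\<integral>\<^sup>+w. ennreal (2 * w) \<partial>\<mu>)"
      by (subst nn_integral_add) (simp_all add: stat)
    finally show ?thesis
      using bd by (auto simp: ennreal_add_left_cancel_le top_unique)
  qed
  \<comment> \<open>The probability of an arrival in the first time unit. Being nonzero, it can be
    divided out at the end.\<close>
  define a where "a = (\<integral>\<^sup>+z. indicator {..1} (fst (z 0)) \<partial>input)"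
  have "a \<noteq> 0"
  proof
    assume "a = 0"
    then have "AE z in input. indicator {..1} (fst (z 0)) = (0::ennreal)"
      unfolding a_def by (subst (asm) nn_integral_0_iff_AE) measurable
    then have "AE z in input. z \<in> {z. 1 < fst (z 0)}" by (auto simp: indicator_def not_le)
    moreover have "{z. 1 < fst (z 0)} \<in> sets input"
    proof -
      have "{z \<in> space input. 1 < fst (z 0)} \<in> sets input" by measurable
      then show ?thesis by simp
    qed
    ultimately have "emeasure input {z. 1 < fst (z 0)} = 1"
      using input.emeasure_eq_1_AE by blast
    then show False using emeasure_first_arrival_after[of 1] rate_pos
      by (simp add: ennreal_eq_1)
  qed
  have iter: "(\<integral>\<^sup>+z. indicator {..1} (fst (z 0)) * f (snd (z 0)) \<partial>input) = a * (\<integral>\<^sup>+s. f s \<partial>G)"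
    if [measurable]: "f \<in> borel_measurable borel" for f :: "real \<Rightarrow> ennreal"
  proof -
    have *: "(\<integral>\<^sup>+z. indicator {..1} (fst (z 0)) * f (snd (z 0)) \<partial>input) = emeasure expo {..1} * (\<integral>\<^sup>+s. f s \<partial>G)"
      if [measurable]: "f \<in> borel_measurable borel" for f :: "real \<Rightarrow> ennreal"
    proof -
      have "(\<integral>\<^sup>+z. indicator {..1} (fst (z 0)) * f (snd (z 0)) \<partial>input) =
        (\<integral>\<^sup>+a. \<integral>\<^sup>+s. \<integral>\<^sup>+z. indicator {..1} a * f s \<partial>input \<partial>G \<partial>expo)"
        by (subst nn_integral_input_iterate) auto
      also have "\<dots> = (\<integral>\<^sup>+a. indicator {..1} a * (\<integral>\<^sup>+s. f s \<partial>G) \<partial>expo)"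
        using input.emeasure_space_1 by (simp add: nn_integral_cmult)
      also have "\<dots> = emeasure expo {..1} * (\<integral>\<^sup>+s. f s \<partial>G)"
        by (subst nn_integral_multc, measurable)
      finally show ?thesis .
    qed
    have "a = emeasure expo {..1}" using *[of "\<lambda>_. 1"] G.emeasure_space_1 by (simp add: a_def)
    then show ?thesis using * that by simp
  qed
  have "a * (\<integral>\<^sup>+s. ennreal ((max 0 (s - 1))\<^sup>2) \<partial>G) =
     (\<integral>\<^sup>+w. a * (\<integral>\<^sup>+s. ennreal ((max 0 (s - 1))\<^sup>2) \<partial>G) \<partial>\<mu>)"
    using \<mu>.emeasure_space_1 by simp
  \<comment> \<open>The same \<open>k\<close> restricts the workload and caps the service. Both
    truncations increase with \<open>k\<close>, so one monotone limit removes them together.\<close>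
  also have "\<dots> = (\<integral>\<^sup>+w. (SUP k::nat. indicator {..real k} w * (a * (\<integral>\<^sup>+s. h k s \<partial>G))) \<partial>\<mu>)"
  proof (rule nn_integral_cong)
    fix w
    have inc: "incseq (\<lambda>k. h k s)" for s
      unfolding h_def incseq_def by (auto intro!: ennreal_leI power_mono)
    have sup: "ennreal ((max 0 (s - 1))\<^sup>2) = (SUP k. h k s)" for s
    proof -
      obtain k :: nat where k: "max 0 (s - 1) \<le> real k" using real_arch_simple by blast
      then have "h k s = ennreal ((max 0 (s - 1))\<^sup>2)" by (simp add: h_def min_absorb2)
      then show ?thesis
        by (intro antisym SUP_upper2[of k] SUP_least) (auto simp: h_def intro!: ennreal_leI power_mono)
    qed
    have incG: "incseq (\<lambda>k. \<integral>\<^sup>+s. h k s \<partial>G)"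
      using inc by (auto simp: incseq_def intro!: nn_integral_mono)
    have "(\<integral>\<^sup>+s. ennreal ((max 0 (s - 1))\<^sup>2) \<partial>G) = (SUP k. \<integral>\<^sup>+s. h k s \<partial>G)"
      unfolding sup using inc by (intro nn_integral_monotone_convergence_SUP) (auto simp: incseq_def le_fun_def)
    also have "a * \<dots> = (SUP k. a * (\<integral>\<^sup>+s. h k s \<partial>G))"
      by (rule SUP_mult_left_ennreal)
    also have "\<dots> = (SUP k::nat. indicator {..real k} w * (a * (\<integral>\<^sup>+s. h k s \<partial>G)))"
    proof (intro antisym SUP_least)
      fix k
      \<comment> \<open>Passing to the index \<open>max k l\<close> switches the indicator on
        without decreasing the integral.\<close>
      obtain l :: nat where l: "w \<le> real l" using real_arch_simple by blast
      have "a * (\<integral>\<^sup>+s. h k s \<partial>G) \<le> a * (\<integral>\<^sup>+s. h (max k l) s \<partial>G)"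
        using incG by (intro mult_left_mono) (auto simp: incseq_def)
      also have "\<dots> = indicator {..real (max k l)} w * (a * (\<integral>\<^sup>+s. h (max k l) s \<partial>G))"
        using l by simp
      also have "\<dots> \<le> (SUP k::nat. indicator {..real k} w * (a * (\<integral>\<^sup>+s. h k s \<partial>G)))"
        by (rule SUP_upper) simp
      finally show "a * (\<integral>\<^sup>+s. h k s \<partial>G) \<le> (SUP k::nat. indicator {..real k} w * (a * (\<integral>\<^sup>+s. h k s \<partial>G)))" .
      show "indicator {..real k} w * (a * (\<integral>\<^sup>+s. h k s \<partial>G)) \<le> (SUP k. a * (\<integral>\<^sup>+s. h k s \<partial>G))"
        by (rule SUP_upper2[of k]) (auto simp: indicator_def)
    qed
    finally show "a * (\<integral>\<^sup>+s. ennreal ((max 0 (s - 1))\<^sup>2) \<partial>G) = (SUP k::nat. indicator {..real k} w * (a * (\<integral>\<^sup>+s. h k s \<partial>G)))" .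
  qed
  also have "\<dots> = (SUP k::nat. \<integral>\<^sup>+w. indicator {..real k} w * (a * (\<integral>\<^sup>+s. h k s \<partial>G)) \<partial>\<mu>)"
    by (intro nn_integral_monotone_convergence_SUP)
       (auto simp: incseq_def le_fun_def indicator_def h_def intro!: mult_left_mono nn_integral_mono ennreal_leI power_mono)
  also have "\<dots> \<le> (\<integral>\<^sup>+w. ennreal (2 * w) \<partial>\<mu>)"
    using le by (intro SUP_least) (simp add: iter)
  also have "\<dots> = 2 * (\<integral>\<^sup>+w. ennreal w \<partial>\<mu>)"
    by (subst nn_integral_cmult[symmetric]) (auto simp: ennreal_mult')
  also have "\<dots> < \<infinity>" using mean by (simp add: ennreal_mult_less_top)
  finally have fin: "(\<integral>\<^sup>+s. ennreal ((max 0 (s - 1))\<^sup>2) \<partial>G) < \<infinity>"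
    using \<open>a \<noteq> 0\<close> by (auto simp: ennreal_mult_less_top)
  have "(\<integral>\<^sup>+s. ennreal (s\<^sup>2) \<partial>G) \<le> (\<integral>\<^sup>+s. 2 * ennreal ((max 0 (s - 1))\<^sup>2) + 2 \<partial>G)"
  proof (rule nn_integral_mono_AE)
    show "AE s in G. ennreal (s\<^sup>2) \<le> 2 * ennreal ((max 0 (s - 1))\<^sup>2) + 2"
      using service_pos
    proof eventually_elim
      case (elim s)
      have "s\<^sup>2 \<le> (max 0 (s - 1) + 1)\<^sup>2" using elim by (intro power_mono) auto
      \<comment> \<open>With \<open>x = max 0 (s - 1)\<close> this is
        \<open>0 <= (x - 1)\<^sup>2\<close>.\<close>
      also have "\<dots> \<le> 2 * (max 0 (s - 1))\<^sup>2 + 2"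
        using sum_squares_ge_zero[of "max 0 (s - 1) - 1" 0] by (simp add: power2_eq_square algebra_simps)
      finally have "ennreal (s\<^sup>2) \<le> ennreal (2 * (max 0 (s - 1))\<^sup>2 + 2)" by (rule ennreal_leI)
      then show ?case by (simp add: ennreal_mult)
    qed
  qed
  also have "\<dots> = 2 * (\<integral>\<^sup>+s. ennreal ((max 0 (s - 1))\<^sup>2) \<partial>G) + 2"
    using G.emeasure_space_1 by (simp add: nn_integral_add nn_integral_cmult)
  also have "\<dots> < \<infinity>" using fin by (simp add: ennreal_mult_less_top)
  finally show ?thesis .
qed

end

section \<open>Foster-Lyapunov bound for the time until all queues are empty\<close>

text \<open>The step length \<open>len\<close> depends on the state: far from the origin one time unit suffices
  for a negative drift, near it the step must be long enough for all queues to empty during a step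
  without arrivals.\<close>

primrec elapsed :: "nat \<Rightarrow> ((nat \<Rightarrow> real) \<Rightarrow> real) \<Rightarrow> nat \<Rightarrow> (nat \<Rightarrow> real) \<Rightarrow> (nat \<Rightarrow> input) \<Rightarrow> ennreal" where
  "elapsed c len 0 w \<iota> = 0"
| "elapsed c len (Suc n) w \<iota> = (if \<forall>j<c. w j = 0 then 0 else
     ennreal (len w) + elapsed c len n (\<lambda>j\<in>{..<c}. workload (w j) (\<iota> j) (len w)) (\<lambda>j\<in>{..<c}. shift_input (len w) (\<iota> j)))"

lemma measurable_elapsed [measurable]:
  assumes [measurable]: "len \<in> borel_measurable (PiM {..<c} (\<lambda>_. borel))"
    and "w \<in> N \<rightarrow>\<^sub>M PiM {..<c} (\<lambda>_. borel)" "\<iota> \<in> N \<rightarrow>\<^sub>M PiM {..<c} (\<lambda>_. input_space)"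
  shows "(\<lambda>x. elapsed c len n (w x) (\<iota> x)) \<in> borel_measurable N"
  using assms(2,3)
proof (induction n arbitrary: w \<iota>)
  case (Suc n)
  note Suc.prems [measurable]
  have wm [measurable]: "(\<lambda>x. w x j) \<in> borel_measurable N" if "j \<in> {..<c}" for j
    using measurable_compose[OF Suc.prems(1) measurable_component_singleton[OF that]] by simp
  have [measurable]: "(\<lambda>x. \<iota> x j) \<in> N \<rightarrow>\<^sub>M input_space" if "j \<in> {..<c}" for j
    using measurable_compose[OF Suc.prems(2) measurable_component_singleton[OF that]] by simp
  have [measurable]: "(\<lambda>x. elapsed c len n (\<lambda>j\<in>{..<c}. workload (w x j) (\<iota> x j) (len (w x)))
      (\<lambda>j\<in>{..<c}. shift_input (len (w x)) (\<iota> x j))) \<in> borel_measurable N"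
    by (rule Suc.IH; rule measurable_restrict; measurable)
  have [measurable]: "Measurable.pred N (\<lambda>x. \<forall>j<c. w x j = 0)"
  proof -
    have "{x \<in> space N. \<forall>j\<in>{..<c}. w x j = 0} \<in> sets N"
      by (intro sets.sets_Collect_finite_All borel_measurable_eq wm) simp_all
    then show ?thesis by (simp add: pred_def lessThan_def)
  qed
  show ?case by simp
qed simp

lemma elapsed_mono: "elapsed c len n w \<iota> \<le> elapsed c len (Suc n) w \<iota>"
proof (induction n arbitrary: w \<iota>)
  case (Suc n)
  show ?case
    unfolding elapsed.simps(2)[of c len "Suc n" w \<iota>] elapsed.simps(2)[of c len n w \<iota>]
    by (auto intro: add_left_mono Suc.IH simp del: elapsed.simps)
qed simp

text \<open>Every step lasts at least one unit, so \<open>n\<close> steps either use up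
  \<open>n\<close> units or meet a zero state. Hence the supremum of \<open>elapsed\<close> over
  \<open>n\<close> dominates the hitting time; it is infinite if no zero state is ever met at the
  observed times.\<close>

lemma elapsed_dominates:
  assumes "\<And>w. 1 \<le> len w" "\<And>j. j < c \<Longrightarrow> regular (\<iota> j)" "\<And>j. j < c \<Longrightarrow> 0 \<le> w j"
  shows "ennreal (real n) \<le> elapsed c len n w \<iota> \<or>
    (\<exists>t\<ge>0. ennreal t \<le> elapsed c len n w \<iota> \<and> (\<forall>j<c. workload (w j) (\<iota> j) t = 0))"
  using assms(2,3)
proof (induction n arbitrary: w \<iota>)
  case (Suc n)
  show ?case
  proof (cases "\<forall>j<c. w j = 0")
    case True
    then show ?thesis using Suc.prems by (intro disjI2 exI[of _ 0]) (simp add: workload_0)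
  next
    case False
    define w' where "w' = (\<lambda>j\<in>{..<c}. workload (w j) (\<iota> j) (len w))"
    define \<iota>' where "\<iota>' = (\<lambda>j\<in>{..<c}. shift_input (len w) (\<iota> j))"
    have l: "1 \<le> len w" by fact
    have E: "elapsed c len (Suc n) w \<iota> = ennreal (len w) + elapsed c len n w' \<iota>'"
      using False by (auto simp: w'_def \<iota>'_def)
    have "ennreal (real n) \<le> elapsed c len n w' \<iota>' \<or>
      (\<exists>t\<ge>0. ennreal t \<le> elapsed c len n w' \<iota>' \<and> (\<forall>j<c. workload (w' j) (\<iota>' j) t = 0))"
      by (rule Suc.IH) (auto simp: w'_def \<iota>'_def regular_shift Suc.prems workload_nonneg)
    then show ?thesis
    proof (elim disjE exE conjE)
      assume "ennreal (real n) \<le> elapsed c len n w' \<iota>'"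
      then have "ennreal 1 + ennreal (real n) \<le> elapsed c len (Suc n) w \<iota>"
        unfolding E using l by (intro add_mono ennreal_leI)
      then show ?thesis by (subst (asm) ennreal_plus[symmetric]) auto
    next
      fix t assume t: "0 \<le> t" "ennreal t \<le> elapsed c len n w' \<iota>'" "\<forall>j<c. workload (w' j) (\<iota>' j) t = 0"
      have "ennreal (len w) + ennreal t \<le> elapsed c len (Suc n) w \<iota>"
        unfolding E using t(2) by (rule add_left_mono)
      then have "ennreal (len w + t) \<le> elapsed c len (Suc n) w \<iota>" using l t(1) by simp
      moreover have "workload (w j) (\<iota> j) (len w + t) = 0" if "j < c" for j
        using that t l Suc.prems by (subst workload_add) (auto simp: w'_def \<iota>'_def)
      ultimately show ?thesis using l t(1) by (intro disjI2 exI[of _ "len w + t"]) auto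
    qed
  qed
qed simp

context mg1_input
begin

text \<open>Foster's argument for finitely many steps: the drift inequality pays for the first step,
  the induction hypothesis for the others. Given \<open>w\<close>, the length \<open>len w\<close>
  is a number, so the Markov property at fixed times is enough.\<close>

lemma nn_integral_elapsed_le:
  assumes [measurable]: "len \<in> borel_measurable (PiM {..<c} (\<lambda>_. borel))"
    and [measurable]: "U \<in> borel_measurable (PiM {..<c} (\<lambda>_. borel))"
    and pos: "\<And>w. 0 \<le> len w"
    and lyapunov: "\<And>w. (\<And>j. j < c \<Longrightarrow> 0 \<le> w j) \<Longrightarrow> \<exists>j<c. w j \<noteq> 0 \<Longrightarrow>
      ennreal (len w) + (\<integral>\<^sup>+\<iota>. U (\<lambda>j\<in>{..<c}. workload (w j) (\<iota> j) (len w)) \<partial>PiM {..<c} (\<lambda>_. input)) \<le> U w"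
    and w: "\<And>j. j < c \<Longrightarrow> 0 \<le> w j" "w \<in> space (PiM {..<c} (\<lambda>_. borel))"
  shows "(\<integral>\<^sup>+\<iota>. elapsed c len n w \<iota> \<partial>PiM {..<c} (\<lambda>_. input)) \<le> U w"
  using w
proof (induction n arbitrary: w)
  case 0
  have "elapsed c len 0 w = (\<lambda>_. 0)" by (simp add: fun_eq_iff)
  then show ?case by simp
next
  case (Suc n)
  interpret P: prob_space "PiM {..<c} (\<lambda>_. input)"
    by (intro prob_space_PiM input.prob_space_axioms)
  show ?case
  proof (cases "\<exists>j<c. w j \<noteq> 0")
    case True
    let ?W = "\<lambda>\<iota>. \<lambda>j\<in>{..<c}. workload (w j) (\<iota> j) (len w)"
    have F: "(\<lambda>(w, \<iota>). elapsed c len n w \<iota>) \<in> borel_measurable (PiM {..<c} (\<lambda>_. borel) \<Otimes>\<^sub>M PiM {..<c} (\<lambda>_. input))"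
    proof -
      have "(\<lambda>(w, \<iota>). elapsed c len n w \<iota>) \<in> borel_measurable (PiM {..<c} (\<lambda>_. borel) \<Otimes>\<^sub>M PiM {..<c} (\<lambda>_. input_space))"
        by measurable
      then show ?thesis
        by (subst measurable_cong_sets[OF sets_pair_measure_cong[OF refl sets_PiM_cong[OF refl sets_input]] refl])
    qed
    have "(\<integral>\<^sup>+\<iota>. elapsed c len (Suc n) w \<iota> \<partial>PiM {..<c} (\<lambda>_. input)) =
      (\<integral>\<^sup>+\<iota>. ennreal (len w) + elapsed c len n (?W \<iota>) (\<lambda>j\<in>{..<c}. shift_input (len w) (\<iota> j)) \<partial>PiM {..<c} (\<lambda>_. input))"
      using True by (intro nn_integral_cong) auto
    also have "\<dots> = ennreal (len w) + (\<integral>\<^sup>+\<iota>. elapsed c len n (?W \<iota>) (\<lambda>j\<in>{..<c}. shift_input (len w) (\<iota> j)) \<partial>PiM {..<c} (\<lambda>_. input))"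
      using P.emeasure_space_1 by (simp add: nn_integral_add)
    also have "(\<integral>\<^sup>+\<iota>. elapsed c len n (?W \<iota>) (\<lambda>j\<in>{..<c}. shift_input (len w) (\<iota> j)) \<partial>PiM {..<c} (\<lambda>_. input)) =
      (\<integral>\<^sup>+\<iota>. \<integral>\<^sup>+\<iota>'. elapsed c len n (?W \<iota>) \<iota>' \<partial>PiM {..<c} (\<lambda>_. input) \<partial>PiM {..<c} (\<lambda>_. input))"
      using markov_PiM[OF _ F pos, of w w] by simp
    also have "\<dots> \<le> (\<integral>\<^sup>+\<iota>. U (?W \<iota>) \<partial>PiM {..<c} (\<lambda>_. input))"
      by (intro nn_integral_mono Suc.IH) (auto simp: workload_nonneg space_PiM)
    also have "ennreal (len w) + \<dots> \<le> U w"
      using Suc.prems(1) True by (rule lyapunov)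
    finally show ?thesis by (simp add: add_left_mono)
  qed auto
qed

section \<open>The Lyapunov function of the joint workload vector\<close>

context
  fixes m q :: real and c :: nat
  assumes m: "0 \<le> m" and mean_le: "(\<integral>\<^sup>+s. ennreal s \<partial>G) \<le> ennreal m" and stable: "r * m < 1"
    and q: "0 \<le> q" and square_le: "(\<integral>\<^sup>+s. ennreal (s\<^sup>2) \<partial>G) \<le> ennreal q"
    and c: "1 \<le> c"
begin

abbreviation (input) dr where "dr \<equiv> drift m"
abbreviation (input) sp where "sp \<equiv> spread m q"
abbreviation (input) Inp where "Inp \<equiv> PiM {..<c} (\<lambda>_. input)"

text \<open>With \<open>N\<close> the norm of \<open>w\<close>, the expected squared norm falls by
  \<open>2 * dr\<close> times the sum of the workloads, which is at least \<open>N\<close>, up to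
  the constant \<open>real c * sp\<close>. Beyond the stated radius this constant is at most
  \<open>dr * N\<close>; a net decrease \<open>dr * N\<close> of the square becomes
  \<open>dr / 2\<close> after division by \<open>2 * N\<close>.\<close>

lemma nn_integral_norm_far:
  assumes w: "\<And>j. j < c \<Longrightarrow> 0 \<le> w j" and far: "real c * sp / dr \<le> L2_set w {..<c}"
  shows "(\<integral>\<^sup>+\<iota>. ennreal (L2_set (\<lambda>j\<in>{..<c}. workload (w j) (\<iota> j) 1) {..<c}) \<partial>Inp)
    \<le> ennreal (L2_set w {..<c} - dr / 2)"
proof -
  note d = drift_pos[OF m mean_le stable q square_le]
  define N where "N = L2_set w {..<c}"
  have "0 < real c * sp / dr"
    using c d spread_ge_2[OF m mean_le stable q square_le] by simp
  then have N: "0 < N" using far by (simp add: N_def)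
  have N2: "N\<^sup>2 = (\<Sum>j<c. (w j)\<^sup>2)" by (simp add: N_def L2_set_def sum_nonneg)
  let ?W = "\<lambda>\<iota> j. workload (w j) (\<iota> j) 1"
  have "(\<integral>\<^sup>+\<iota>. ennreal (L2_set (\<lambda>j\<in>{..<c}. ?W \<iota> j) {..<c}) \<partial>Inp) \<le>
     (\<integral>\<^sup>+\<iota>. ennreal (1 / (2 * N)) * ((\<Sum>j<c. ennreal ((?W \<iota> j)\<^sup>2)) + ennreal (N\<^sup>2)) \<partial>Inp)"
  proof (rule nn_integral_mono)
    fix \<iota> :: "nat \<Rightarrow> input"
    define V where "V = L2_set (\<lambda>j\<in>{..<c}. ?W \<iota> j) {..<c}"
    have V2: "V\<^sup>2 = (\<Sum>j<c. (?W \<iota> j)\<^sup>2)" by (simp add: V_def L2_set_def sum_nonneg)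
    \<comment> \<open>AM-GM replaces Jensen's inequality for the square root.\<close>
    have "2 * N * V \<le> V\<^sup>2 + N\<^sup>2" using sum_squares_ge_zero[of "V - N" 0] by (simp add: power2_eq_square algebra_simps)
    then have "V \<le> 1 / (2 * N) * ((\<Sum>j<c. (?W \<iota> j)\<^sup>2) + N\<^sup>2)"
      using N unfolding V2[symmetric] by (simp add: field_simps)
    then have "ennreal V \<le> ennreal (1 / (2 * N) * ((\<Sum>j<c. (?W \<iota> j)\<^sup>2) + N\<^sup>2))" by (rule ennreal_leI)
    also have "\<dots> = ennreal (1 / (2 * N)) * ((\<Sum>j<c. ennreal ((?W \<iota> j)\<^sup>2)) + ennreal (N\<^sup>2))"
      using N by (subst ennreal_mult) (auto simp: sum_nonneg sum_ennreal)
    finally show "ennreal (L2_set (\<lambda>j\<in>{..<c}. ?W \<iota> j) {..<c}) \<le>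
      ennreal (1 / (2 * N)) * ((\<Sum>j<c. ennreal ((?W \<iota> j)\<^sup>2)) + ennreal (N\<^sup>2))" unfolding V_def .
  qed
  also have "\<dots> = ennreal (1 / (2 * N)) * ((\<Sum>j<c. \<integral>\<^sup>+\<iota>. ennreal ((?W \<iota> j)\<^sup>2) \<partial>Inp) + ennreal (N\<^sup>2))"
  proof -
    interpret P: prob_space Inp by (intro prob_space_PiM input.prob_space_axioms)
    have [measurable]: "(\<lambda>\<iota>. ?W \<iota> j) \<in> borel_measurable Inp" if "j \<in> {..<c}" for j
      using that by measurable
    have [measurable]: "(\<lambda>\<iota>. \<Sum>j<c. ennreal ((?W \<iota> j)\<^sup>2)) \<in> borel_measurable Inp"
      by (rule borel_measurable_sum) measurable
    have "(\<integral>\<^sup>+\<iota>. ennreal (1 / (2 * N)) * ((\<Sum>j<c. ennreal ((?W \<iota> j)\<^sup>2)) + ennreal (N\<^sup>2)) \<partial>Inp) =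
      ennreal (1 / (2 * N)) * ((\<integral>\<^sup>+\<iota>. (\<Sum>j<c. ennreal ((?W \<iota> j)\<^sup>2)) \<partial>Inp) + ennreal (N\<^sup>2))"
      using P.emeasure_space_1 by (simp add: nn_integral_cmult nn_integral_add)
    also have "(\<integral>\<^sup>+\<iota>. (\<Sum>j<c. ennreal ((?W \<iota> j)\<^sup>2)) \<partial>Inp) = (\<Sum>j<c. \<integral>\<^sup>+\<iota>. ennreal ((?W \<iota> j)\<^sup>2) \<partial>Inp)"
      by (rule nn_integral_sum) measurable
    finally show ?thesis .
  qed
  also have "\<dots> \<le> ennreal (1 / (2 * N)) * ((\<Sum>j<c. ennreal ((w j)\<^sup>2 - 2 * dr * w j + sp)) + ennreal (N\<^sup>2))"
  proof (intro mult_left_mono add_right_mono sum_mono)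
    fix j assume j: "j \<in> {..<c}"
    have "(\<integral>\<^sup>+\<iota>. ennreal ((?W \<iota> j)\<^sup>2) \<partial>Inp) = (\<integral>\<^sup>+z. ennreal ((workload (w j) z 1)\<^sup>2) \<partial>input)"
      using j by (intro nn_integral_PiM_component) measurable
    also have "\<dots> \<le> ennreal ((w j)\<^sup>2 - 2 * dr * w j + sp)"
      using w j by (intro nn_integral_workload_square[OF m mean_le stable q square_le]) auto
    finally show "(\<integral>\<^sup>+\<iota>. ennreal ((?W \<iota> j)\<^sup>2) \<partial>Inp) \<le> ennreal ((w j)\<^sup>2 - 2 * dr * w j + sp)" .
  qed simp
  also have "\<dots> = ennreal (1 / (2 * N) * ((\<Sum>j<c. (w j)\<^sup>2 - 2 * dr * w j + sp) + N\<^sup>2))"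
  proof -
    have "0 \<le> (\<Sum>j<c. (w j)\<^sup>2 - 2 * dr * w j + sp)"
      by (intro sum_nonneg drift_spread_nonneg[OF m mean_le stable q square_le])
    then show ?thesis
      using N drift_spread_nonneg[OF m mean_le stable q square_le]
      by (subst ennreal_mult) (simp_all add: sum_ennreal)
  qed
  also have "\<dots> \<le> ennreal (N - dr / 2)"
  proof (rule ennreal_leI)
    have S: "N \<le> (\<Sum>j<c. w j)"
      unfolding N_def by (rule L2_set_le_sum) (use w in auto)
    have "(\<Sum>j<c. (w j)\<^sup>2 - 2 * dr * w j + sp) = N\<^sup>2 - 2 * dr * (\<Sum>j<c. w j) + real c * sp"
      by (simp add: N2 sum.distrib sum_subtractf sum_distrib_left)
    also have "\<dots> \<le> N\<^sup>2 - 2 * dr * N + real c * sp"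
      using S d by simp
    also have "real c * sp \<le> dr * N" using far d by (simp add: N_def field_simps)
    finally have "(\<Sum>j<c. (w j)\<^sup>2 - 2 * dr * w j + sp) + N\<^sup>2 \<le> 2 * N * (N - dr / 2)"
      by (simp add: power2_eq_square algebra_simps)
    then show "1 / (2 * N) * ((\<Sum>j<c. (w j)\<^sup>2 - 2 * dr * w j + sp) + N\<^sup>2) \<le> N - dr / 2"
      using N by (simp add: field_simps)
  qed
  finally show ?thesis unfolding N_def .
qed

text \<open>A step at least as long as the norm drains every initial workload, so at its end only
  work that arrived meanwhile can be left.\<close>

lemma nn_integral_norm_near:
  assumes w: "\<And>j. j < c \<Longrightarrow> 0 \<le> w j" and near: "L2_set w {..<c} \<le> t"
  shows "(\<integral>\<^sup>+\<iota>. ennreal (L2_set (\<lambda>j\<in>{..<c}. workload (w j) (\<iota> j) t) {..<c}) \<partial>Inp)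
    \<le> ennreal (real c * (r * t * m))"
proof -
  have t: "0 \<le> t" by (rule order_trans[OF L2_set_nonneg near])
  have wt: "w j \<le> t" if "j < c" for j
    using member_le_L2_set[of "{..<c}" j w] that near by auto
  have [measurable]: "(\<lambda>\<iota>. workload (w j) (\<iota> j) t) \<in> borel_measurable Inp" if "j \<in> {..<c}" for j
    using that by measurable
  have "(\<integral>\<^sup>+\<iota>. ennreal (L2_set (\<lambda>j\<in>{..<c}. workload (w j) (\<iota> j) t) {..<c}) \<partial>Inp)
    \<le> (\<integral>\<^sup>+\<iota>. (\<Sum>j<c. ennreal (workload (w j) (\<iota> j) t)) \<partial>Inp)"
  proof (rule nn_integral_mono)
    fix \<iota> :: "nat \<Rightarrow> input"
    have "L2_set (\<lambda>j\<in>{..<c}. workload (w j) (\<iota> j) t) {..<c} \<le> (\<Sum>j<c. (\<lambda>j\<in>{..<c}. workload (w j) (\<iota> j) t) j)"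
      by (rule L2_set_le_sum) (simp add: workload_nonneg)
    then show "ennreal (L2_set (\<lambda>j\<in>{..<c}. workload (w j) (\<iota> j) t) {..<c}) \<le> (\<Sum>j<c. ennreal (workload (w j) (\<iota> j) t))"
      by (simp add: sum_ennreal workload_nonneg ennreal_leI)
  qed
  also have "\<dots> = (\<Sum>j<c. \<integral>\<^sup>+\<iota>. ennreal (workload (w j) (\<iota> j) t) \<partial>Inp)"
    by (rule nn_integral_sum) measurable
  also have "\<dots> \<le> (\<Sum>j<c. ennreal (r * t * m))"
  proof (rule sum_mono)
    fix j assume j: "j \<in> {..<c}"
    have "(\<integral>\<^sup>+\<iota>. ennreal (workload (w j) (\<iota> j) t) \<partial>Inp) = (\<integral>\<^sup>+z. ennreal (workload (w j) z t) \<partial>input)"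
      using j by (intro nn_integral_PiM_component) measurable
    also have "\<dots> \<le> (\<integral>\<^sup>+z. ennreal (load z t) \<partial>input)"
    proof (rule nn_integral_mono_AE)
      show "AE z in input. ennreal (workload (w j) z t) \<le> ennreal (load z t)"
        using AE_regular
      proof eventually_elim
        case (elim z)
        show ?case using workload_le_load[OF elim t, of "w j"] wt[of j] j by (intro ennreal_leI) auto
      qed
    qed
    also have "\<dots> \<le> ennreal (r * t * m)" by (rule nn_integral_load[OF m mean_le t])
    finally show "(\<integral>\<^sup>+\<iota>. ennreal (workload (w j) (\<iota> j) t) \<partial>Inp) \<le> ennreal (r * t * m)" .
  qed
  also have "\<dots> = ennreal (real c * (r * t * m))"
    using t m rate_pos by (subst sum_ennreal) auto
  finally show ?thesis .
qed

text \<open>If no queue has an arrival up to \<open>t\<close>, all initial work is gone by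
  \<open>t\<close>. These events are independent over the queues, which gives the power
  \<open>c\<close>.\<close>

lemma emeasure_nonempty_near:
  assumes w: "\<And>j. j < c \<Longrightarrow> 0 \<le> w j" and near: "L2_set w {..<c} \<le> t"
  shows "(\<integral>\<^sup>+\<iota>. (if \<exists>j<c. workload (w j) (\<iota> j) t \<noteq> 0 then 1 else 0) \<partial>Inp) \<le> ennreal (1 - exp (- r * t) ^ c)"
proof -
  interpret P: prob_space Inp by (intro prob_space_PiM input.prob_space_axioms)
  interpret PP: product_prob_space "\<lambda>_::nat. input" "{..<c}"
    by (intro product_prob_spaceI input.prob_space_axioms)
  have t: "0 \<le> t" by (rule order_trans[OF L2_set_nonneg near])
  have wt: "w j \<le> t" if "j < c" for j
    using member_le_L2_set[of "{..<c}" j w] that near by auto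
  define Q where "Q = {\<iota> \<in> space Inp. \<forall>j\<in>{..<c}. \<iota> j \<in> {z. t < fst (z 0)}}"
  have S: "{z. t < fst (z 0)} \<in> sets input"
  proof -
    have "{z \<in> space input. t < fst (z 0)} \<in> sets input" by measurable
    then show ?thesis by simp
  qed
  have Q: "emeasure Inp Q = ennreal (exp (- r * t) ^ c)"
    unfolding Q_def using S t
    by (subst PP.emeasure_PiM_Collect) (auto simp: emeasure_first_arrival_after prod_ennreal ennreal_power)
  have Qs: "Q \<in> sets Inp"
  proof -
    have "{\<iota> \<in> space Inp. \<iota> j \<in> {z. t < fst (z 0)}} \<in> sets Inp" if "j \<in> {..<c}" for j
      using measurable_sets[OF measurable_component_singleton[OF that, of "\<lambda>_. input"] S]
      by (simp add: vimage_def Int_def conj_commute)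
    then show ?thesis unfolding Q_def by (rule sets.sets_Collect_finite_All) auto
  qed
  have "AE \<iota> in Inp. \<forall>j\<in>{..<c}. regular (\<iota> j)"
    by (intro eventually_ball_finite ballI AE_PiM_component[of "{..<c}" "\<lambda>_. input" _ regular] AE_regular input.prob_space_axioms) auto
  then have "(\<integral>\<^sup>+\<iota>. (if \<exists>j<c. workload (w j) (\<iota> j) t \<noteq> 0 then 1 else 0) \<partial>Inp) \<le>
     (\<integral>\<^sup>+\<iota>. indicator (space Inp - Q) \<iota> \<partial>Inp)"
  proof (intro nn_integral_mono_AE, elim AE_mp, intro AE_I2 impI)
    fix \<iota> assume \<iota>: "\<iota> \<in> space Inp" "\<forall>j\<in>{..<c}. regular (\<iota> j)"
    show "(if \<exists>j<c. workload (w j) (\<iota> j) t \<noteq> 0 then 1 else 0) \<le> (indicator (space Inp - Q) \<iota> :: ennreal)"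
    proof (cases "\<iota> \<in> Q")
      case True
      then have "workload (w j) (\<iota> j) t = 0" if "j < c" for j
        using that \<iota> wt[OF that] by (subst workload_before) (auto simp: Q_def)
      then show ?thesis by auto
    qed (use \<iota> in simp)
  qed
  also have "\<dots> = emeasure Inp (space Inp - Q)" using Qs by simp
  also have "\<dots> = 1 - ennreal (exp (- r * t) ^ c)"
    using Qs Q P.emeasure_space_1 by (simp add: emeasure_compl)
  also have "\<dots> = ennreal (1 - exp (- r * t) ^ c)"
    by (subst ennreal_minus[symmetric]) auto
  finally show ?thesis .
qed

text \<open>Near the origin the expected norm after a step is bounded and all queues empty with
  probability at least \<open>p\<close>; the weight \<open>D\<close> of the indicator lets this
  chance pay for the norm and for the step. Far out the indicator is already 1 and cannot
  increase.\<close>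

lemma exists_lyapunov:
  "\<exists>len U C D. len \<in> borel_measurable (PiM {..<c} (\<lambda>_. borel)) \<and>
    U \<in> borel_measurable (PiM {..<c} (\<lambda>_. borel)) \<and> (\<forall>w. 1 \<le> len w) \<and>
    (\<forall>w. U w \<le> ennreal C * ennreal (L2_set w {..<c}) + ennreal D) \<and>
    (\<forall>w. (\<forall>j<c. 0 \<le> w j) \<longrightarrow> (\<exists>j<c. w j \<noteq> 0) \<longrightarrow>
      ennreal (len w) + (\<integral>\<^sup>+\<iota>. U (\<lambda>j\<in>{..<c}. workload (w j) (\<iota> j) (len w)) \<partial>Inp) \<le> U w)"
proof -
  interpret P: prob_space Inp by (intro prob_space_PiM input.prob_space_axioms)
  note d = drift_pos[OF m mean_le stable q square_le]
  \<comment> \<open>The radius from \<open>nn_integral_norm_far\<close>, raised to 1 because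
    \<open>R\<close> also serves as a step length.\<close>
  define R where "R = max 1 (real c * sp / dr)"
  define p where "p = exp (- r * R) ^ c"
  \<comment> \<open>\<open>C * dr / 2 = 1\<close> pays for a unit step far out; \<open>D\<close>
    solves the balance near the origin,
    \<open>R + C * (real c * (r * R * m)) + D * (1 - p) = D\<close>.\<close>
  define C where "C = 2 / dr"
  define D where "D = (R + C * (real c * (r * R * m))) / p"
  define len where "len w = (if L2_set w {..<c} < R then R else 1)" for w
  have R: "1 \<le> R" by (simp add: R_def)
  have p: "0 < p" by (simp add: p_def)
  have C: "0 \<le> C" using d by (simp add: C_def)
  have D: "0 \<le> D" using R C p m rate_pos by (simp add: D_def)
  have norm_meas [measurable]: "(\<lambda>w. L2_set w {..<c}) \<in> borel_measurable (PiM {..<c} (\<lambda>_. borel))"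
    unfolding L2_set_def by measurable
  have len: "len \<in> borel_measurable (PiM {..<c} (\<lambda>_. borel))"
    unfolding len_def by measurable
  have nz_meas [measurable]: "(\<lambda>w. if \<exists>j<c. w j \<noteq> (0::real) then 1 else 0 :: ennreal) \<in> borel_measurable (PiM {..<c} (\<lambda>_. borel))"
  proof -
    have "{w \<in> space (PiM {..<c} (\<lambda>_. borel)). \<exists>j\<in>{..<c}. w j \<noteq> (0::real)} \<in> sets (PiM {..<c} (\<lambda>_. borel))"
      by (intro sets.sets_Collect_finite_Ex borel_measurable_neq measurable_component_singleton) simp_all
    then have "Measurable.pred (PiM {..<c} (\<lambda>_. borel)) (\<lambda>w. \<exists>j<c. w j \<noteq> (0::real))"
      by (simp add: pred_def lessThan_def Bex_def)
    then show ?thesis by measurable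
  qed
  have W_meas [measurable]: "(\<lambda>\<iota>. \<lambda>j\<in>{..<c}. workload (w j) (\<iota> j) t) \<in> Inp \<rightarrow>\<^sub>M PiM {..<c} (\<lambda>_. borel)" for w t
    by measurable
  have "ennreal (len w) + (\<integral>\<^sup>+\<iota>. ennreal C * ennreal (L2_set (\<lambda>j\<in>{..<c}. workload (w j) (\<iota> j) (len w)) {..<c}) +
         ennreal D * (if \<exists>j<c. (\<lambda>j\<in>{..<c}. workload (w j) (\<iota> j) (len w)) j \<noteq> 0 then 1 else 0) \<partial>Inp)
      \<le> ennreal C * ennreal (L2_set w {..<c}) + ennreal D * (if \<exists>j<c. w j \<noteq> 0 then 1 else 0)"
    if w: "\<And>j. j < c \<Longrightarrow> 0 \<le> w j" and nz: "\<exists>j<c. w j \<noteq> 0" for w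
  proof -
    let ?W = "\<lambda>\<iota>. \<lambda>j\<in>{..<c}. workload (w j) (\<iota> j) (len w)"
    let ?z = "\<lambda>w. if \<exists>j<c. w j \<noteq> (0::real) then 1 else 0 :: ennreal"
    have "(\<integral>\<^sup>+\<iota>. ennreal C * ennreal (L2_set (?W \<iota>) {..<c}) + ennreal D * ?z (?W \<iota>) \<partial>Inp) =
      (\<integral>\<^sup>+\<iota>. ennreal C * ennreal (L2_set (?W \<iota>) {..<c}) \<partial>Inp) + (\<integral>\<^sup>+\<iota>. ennreal D * ?z (?W \<iota>) \<partial>Inp)"
      by (rule nn_integral_add) (rule measurable_compose[OF W_meas], measurable)+
    also have "(\<integral>\<^sup>+\<iota>. ennreal C * ennreal (L2_set (?W \<iota>) {..<c}) \<partial>Inp) = ennreal C * (\<integral>\<^sup>+\<iota>. ennreal (L2_set (?W \<iota>) {..<c}) \<partial>Inp)"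
      by (rule nn_integral_cmult) (rule measurable_compose[OF W_meas], measurable)
    also have "(\<integral>\<^sup>+\<iota>. ennreal D * ?z (?W \<iota>) \<partial>Inp) = ennreal D * (\<integral>\<^sup>+\<iota>. ?z (?W \<iota>) \<partial>Inp)"
      by (rule nn_integral_cmult) (rule measurable_compose[OF W_meas nz_meas])
    finally have eq: "(\<integral>\<^sup>+\<iota>. ennreal C * ennreal (L2_set (?W \<iota>) {..<c}) + ennreal D * ?z (?W \<iota>) \<partial>Inp) =
      ennreal C * (\<integral>\<^sup>+\<iota>. ennreal (L2_set (?W \<iota>) {..<c}) \<partial>Inp) + ennreal D * (\<integral>\<^sup>+\<iota>. ?z (?W \<iota>) \<partial>Inp)" .
    have zle: "(\<integral>\<^sup>+\<iota>. ?z (?W \<iota>) \<partial>Inp) \<le> 1"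
    proof -
      have "(\<integral>\<^sup>+\<iota>. ?z (?W \<iota>) \<partial>Inp) \<le> (\<integral>\<^sup>+\<iota>. 1 \<partial>Inp)" by (intro nn_integral_mono) auto
      then show ?thesis using P.emeasure_space_1 by simp
    qed
    show ?thesis
    proof (cases "L2_set w {..<c} < R")
      case True
      then have l: "len w = R" by (simp add: len_def)
      have 1: "(\<integral>\<^sup>+\<iota>. ennreal (L2_set (?W \<iota>) {..<c}) \<partial>Inp) \<le> ennreal (real c * (r * R * m))"
        unfolding l by (rule nn_integral_norm_near) (use w True in auto)
      have "(\<integral>\<^sup>+\<iota>. ?z (?W \<iota>) \<partial>Inp) = (\<integral>\<^sup>+\<iota>. (if \<exists>j<c. workload (w j) (\<iota> j) R \<noteq> 0 then 1 else 0) \<partial>Inp)"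
        unfolding l by (intro nn_integral_cong) auto
      also have "\<dots> \<le> ennreal (1 - p)"
        unfolding p_def by (rule emeasure_nonempty_near) (use w True in auto)
      finally have 2: "(\<integral>\<^sup>+\<iota>. ?z (?W \<iota>) \<partial>Inp) \<le> ennreal (1 - p)" .
      have p1: "p \<le> 1" unfolding p_def using rate_pos R by (intro power_le_one) auto
      have "ennreal R + (ennreal C * (\<integral>\<^sup>+\<iota>. ennreal (L2_set (?W \<iota>) {..<c}) \<partial>Inp) + ennreal D * (\<integral>\<^sup>+\<iota>. ?z (?W \<iota>) \<partial>Inp))
        \<le> ennreal R + (ennreal C * ennreal (real c * (r * R * m)) + ennreal D * ennreal (1 - p))"
        by (intro add_mono mult_left_mono 1 2) auto
      also have "\<dots> = ennreal (R + (C * (real c * (r * R * m)) + D * (1 - p)))"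
        using R C D p1 m rate_pos by (simp add: ennreal_mult[symmetric] del: ennreal_plus) (simp add: ennreal_plus[symmetric] del: ennreal_plus)
      also have "R + (C * (real c * (r * R * m)) + D * (1 - p)) = D"
        using p by (simp add: D_def field_simps)
      also have "ennreal D \<le> ennreal C * ennreal (L2_set w {..<c}) + ennreal D"
        by simp
      finally show ?thesis unfolding eq unfolding l if_P[OF nz] mult_1_right .
    next
      case False
      then have l: "len w = 1" and far: "real c * sp / dr \<le> L2_set w {..<c}" by (simp_all add: len_def R_def)
      have 1: "(\<integral>\<^sup>+\<iota>. ennreal (L2_set (?W \<iota>) {..<c}) \<partial>Inp) \<le> ennreal (L2_set w {..<c} - dr / 2)"
        unfolding l by (rule nn_integral_norm_far) (use w far in auto)
      have N: "1 \<le> L2_set w {..<c}" using False R by simp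
      have "ennreal 1 + (ennreal C * (\<integral>\<^sup>+\<iota>. ennreal (L2_set (?W \<iota>) {..<c}) \<partial>Inp) + ennreal D * (\<integral>\<^sup>+\<iota>. ?z (?W \<iota>) \<partial>Inp))
        \<le> ennreal 1 + (ennreal C * ennreal (L2_set w {..<c} - dr / 2) + ennreal D * 1)"
        by (intro add_mono mult_left_mono 1 zle) auto
      also have "\<dots> = ennreal (1 + C * (L2_set w {..<c} - dr / 2)) + ennreal D"
        using C N drift_le_1[OF m mean_le stable q square_le] by (simp add: ennreal_mult add.assoc)
      also have "1 + C * (L2_set w {..<c} - dr / 2) = C * L2_set w {..<c}"
        using d by (simp add: C_def field_simps)
      also have "ennreal \<dots> = ennreal C * ennreal (L2_set w {..<c})"
        using C by (intro ennreal_mult) auto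
      finally show ?thesis unfolding eq unfolding l if_P[OF nz] mult_1_right .
    qed
  qed
  moreover define U where "U w = ennreal C * ennreal (L2_set w {..<c}) + ennreal D * (if \<exists>j<c. w j \<noteq> 0 then 1 else 0)" for w
  moreover have "U \<in> borel_measurable (PiM {..<c} (\<lambda>_. borel))"
    unfolding U_def by measurable
  moreover have "U w \<le> ennreal C * ennreal (L2_set w {..<c}) + ennreal D" for w
    unfolding U_def by (intro add_mono order_refl) auto
  moreover have "1 \<le> len w" for w using R by (simp add: len_def)
  ultimately show ?thesis
    using len by (intro exI[of _ len] exI[of _ U] exI[of _ C] exI[of _ D]) simp
qed

end

end

section \<open>The workload of a configuration\<close>

text \<open>The plain sum for positive residuals. Clipping at 0 matches \<open>ennreal\<close>, so
  this is the real value of an \<open>ennreal\<close> sum, for which measurability is proved by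
  monotone limits.\<close>

definition total_work :: "real multiset \<Rightarrow> real" where
  "total_work X = sum_mset (image_mset (max 0) X)"

lemma total_work_nonneg: "0 \<le> total_work X"
  unfolding total_work_def by (induction X) auto

lemma total_work_eq: "\<forall>x\<in>#X. 0 < x \<Longrightarrow> total_work X = sum_mset X"
  unfolding total_work_def by (induction X) auto

lemma space_config_space [simp]: "space config_space = UNIV"
  by (simp add: config_space_def)

lemma measurable_count_config:
  assumes "B \<in> sets borel"
  shows "(\<lambda>X. of_nat (size (filter_mset (\<lambda>x. x \<in> B) X)) :: ennreal) \<in> borel_measurable config_space"
proof -
  have "(\<lambda>X. size (filter_mset (\<lambda>x. x \<in> B) X)) \<in> config_space \<rightarrow>\<^sub>M count_space UNIV"
  proof (subst measurable_count_space_eq2_countable, intro conjI ballI)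
    fix n :: nat
    have "{X. size (filter_mset (\<lambda>x. x \<in> B) X) = n} \<in> sets config_space"
      unfolding config_space_def using assms by auto
    then show "(\<lambda>X. size (filter_mset (\<lambda>x. x \<in> B) X)) -` {n} \<inter> space config_space \<in> sets config_space"
      by (simp add: vimage_def)
  qed auto
  then show ?thesis by (rule measurable_compose) simp
qed

text \<open>For an indicator function the sum is a counting map, measurable by the choice of
  generators of \<open>config_space\<close>; linearity and increasing limits do the rest.\<close>

lemma measurable_sum_config:
  fixes f :: "real \<Rightarrow> ennreal"
  assumes "f \<in> borel_measurable borel"
  shows "(\<lambda>X. sum_mset (image_mset f X)) \<in> borel_measurable config_space"
  using assms
proof (induction f rule: borel_measurable_induct)
  case (cong f g)
  then have "f = g" by auto
  then show ?case using cong by simp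
next
  case (set B)
  have "sum_mset (image_mset (indicator B) X) = (of_nat (size (filter_mset (\<lambda>x. x \<in> B) X)) :: ennreal)" for X
    by (induction X) (auto simp: indicator_def)
  then show ?case using measurable_count_config[OF set] by simp
next
  case (mult u v)
  have "sum_mset (image_mset (\<lambda>x. v * u x) X) = v * sum_mset (image_mset u X)" for X
    by (induction X) (auto simp: distrib_left)
  then show ?case using mult by simp
next
  case (add u v)
  then show ?case by (simp add: sum_mset.distrib)
next
  case (seq U)
  have inc: "incseq (\<lambda>i. sum_mset (image_mset (U i) X))" for X
    using seq by (auto simp: incseq_def le_fun_def intro!: sum_mset_mono)
  have eq: "sum_mset (image_mset (Sup (range U)) X) = (SUP i. sum_mset (image_mset (U i) X))" for X
  proof (induction X)
    case (add x X)
    have "incseq (\<lambda>i. U i x)" using seq by (auto simp: incseq_def le_fun_def)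
    from ennreal_SUP_add[OF this inc[of X]] show ?case
      using add by (simp add: image_comp)
  qed simp
  show ?case unfolding eq by (rule borel_measurable_SUP) (auto intro: seq)
qed

lemma measurable_total_work [measurable]: "total_work \<in> borel_measurable config_space"
proof -
  have "sum_mset (image_mset ennreal X) = ennreal (total_work X)" for X
  proof (induction X)
    case (add x X)
    have "ennreal x + ennreal (total_work X) = ennreal (max 0 x + total_work X)"
      using total_work_nonneg[of X] by (subst ennreal_plus) auto
    then show ?case using add by (simp add: total_work_def)
  qed (simp add: total_work_def)
  then have "total_work X = enn2real (sum_mset (image_mset ennreal X))" for X
    by (simp add: total_work_nonneg)
  then have eq: "total_work = (\<lambda>X. enn2real (sum_mset (image_mset ennreal X)))" ..
  note measurable_sum_config[of ennreal, measurable]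
  show ?thesis unfolding eq by measurable
qed

section \<open>The joint law of the initial workloads and the inputs\<close>

locale stationary_ps_system = mg1_ps_system M c r G X A S + mg1_input r G
  for M :: "'w measure" and c :: nat and r :: real and G :: "real measure"
    and X :: "nat \<Rightarrow> 'w \<Rightarrow> real multiset" and A S :: "nat \<Rightarrow> nat \<Rightarrow> 'w \<Rightarrow> real" +
  assumes servers: "1 \<le> c"
    and equilibrium: "\<And>j. j < c \<Longrightarrow> in_equilibrium M (ps_queue X A S j)"
begin

definition sources :: "source set" where
  "sources = (\<Union>j<c. {Initial j} \<union> range (Interarrival j) \<union> range (Service j))"

text \<open>Replacing each initial configuration by its total work makes all sources real-valued, so
  that they form a single family for \<open>indep_vars\<close>.\<close>

definition source_var :: "source \<Rightarrow> 'w \<Rightarrow> real" where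
  "source_var src \<omega> = (case src of Initial j \<Rightarrow> total_work (X j \<omega>)
     | Interarrival j n \<Rightarrow> A j n \<omega> | Service j n \<Rightarrow> S j n \<omega>)"

definition initial_work :: "'w \<Rightarrow> nat \<Rightarrow> real" where
  "initial_work \<omega> = (\<lambda>j\<in>{..<c}. total_work (X j \<omega>))"

definition queue_input :: "nat \<Rightarrow> 'w \<Rightarrow> input" where
  "queue_input j \<omega> n = (A j n \<omega>, S j n \<omega>)"

definition inputs :: "'w \<Rightarrow> nat \<Rightarrow> input" where
  "inputs \<omega> = (\<lambda>j\<in>{..<c}. queue_input j \<omega>)"

lemma interarrival_measurable: "j < c \<Longrightarrow> A j n \<in> borel_measurable M"
  using interarrival[of j n] by (simp add: distributed_def)

lemma total_work_initial_measurable: "j < c \<Longrightarrow> (\<lambda>\<omega>. total_work (X j \<omega>)) \<in> borel_measurable M"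
  using initial_measurable[of j] by measurable

lemma source_var_measurable: "src \<in> sources \<Longrightarrow> source_var src \<in> borel_measurable M"
  using interarrival_measurable service_measurable total_work_initial_measurable
  by (auto simp: sources_def source_var_def[abs_def])

text \<open>An event about the initial work is an event about the initial configuration, and
  independence passes to smaller families of events.\<close>

lemma indep_source_vars: "indep_vars (\<lambda>_. borel) source_var sources"
  unfolding indep_vars_def2
proof (intro conjI ballI source_var_measurable)
  show "indep_sets (\<lambda>i. {source_var i -` B \<inter> space M | B. B \<in> sets borel}) sources"
    using indep unfolding sources_def[symmetric]
  proof (rule indep_sets_mono_sets)
    fix src assume "src \<in> sources"
    have "{source_var (Initial j) -` B \<inter> space M | B. B \<in> sets borel} \<subseteq>
        {X j -` B \<inter> space M | B. B \<in> sets config_space}" for j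
    proof safe
      fix B :: "real set" assume B: "B \<in> sets borel"
      have "total_work -` B \<in> sets config_space"
        using measurable_sets[OF measurable_total_work B] by simp
      moreover have "source_var (Initial j) -` B \<inter> space M = X j -` (total_work -` B) \<inter> space M"
        by (auto simp: source_var_def)
      ultimately show "\<exists>B'. source_var (Initial j) -` B \<inter> space M = X j -` B' \<inter> space M \<and> B' \<in> sets config_space"
        by blast
    qed
    then show "{source_var src -` B \<inter> space M | B. B \<in> sets borel} \<subseteq> (case src of
          Initial j \<Rightarrow> {X j -` B \<inter> space M | B. B \<in> sets config_space}
        | Interarrival j n \<Rightarrow> {A j n -` B \<inter> space M | B. B \<in> sets borel}
        | Service j n \<Rightarrow> {S j n -` B \<inter> space M | B. B \<in> sets borel})"
      by (cases src) (auto simp: source_var_def[abs_def])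
  qed
qed

lemma queue_input_measurable [measurable]: "j < c \<Longrightarrow> queue_input j \<in> M \<rightarrow>\<^sub>M input_space"
proof -
  assume j: "j < c"
  note [measurable] = interarrival_measurable[OF j] service_measurable[OF j]
  show ?thesis unfolding queue_input_def[abs_def] by (rule measurable_abs_UNIV) measurable
qed

lemma distr_mark:
  assumes j: "j < c"
  shows "distr M (borel \<Otimes>\<^sub>M borel) (\<lambda>\<omega>. queue_input j \<omega> n) = expo \<Otimes>\<^sub>M G"
proof -
  let ?a = "Interarrival j n" and ?s = "Service j n"
  have "indep_var (PiM {?a} (\<lambda>_. borel)) (\<lambda>\<omega>. \<lambda>i\<in>{?a}. source_var i \<omega>) (PiM {?s} (\<lambda>_. borel)) (\<lambda>\<omega>. \<lambda>i\<in>{?s}. source_var i \<omega>)"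
    by (rule indep_var_restrict[OF indep_source_vars]) (use j in \<open>auto simp: sources_def\<close>)
  then have "indep_var borel ((\<lambda>x. x ?a) \<circ> (\<lambda>\<omega>. \<lambda>i\<in>{?a}. source_var i \<omega>)) borel ((\<lambda>x. x ?s) \<circ> (\<lambda>\<omega>. \<lambda>i\<in>{?s}. source_var i \<omega>))"
    by (rule indep_var_compose) (rule measurable_component_singleton, simp)+
  then have "indep_var borel (A j n) borel (S j n)"
    by (simp add: comp_def source_var_def)
  then have "distr M (borel \<Otimes>\<^sub>M borel) (\<lambda>\<omega>. (A j n \<omega>, S j n \<omega>)) = distr M borel (A j n) \<Otimes>\<^sub>M distr M borel (S j n)"
    by (simp add: indep_var_distribution_eq)
  also have "distr M borel (A j n) = distr M lborel (A j n)"
    by (rule distr_cong) auto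
  also have "\<dots> = expo"
    using interarrival[OF j, of n] by (simp add: distributed_def expo_def)
  finally show ?thesis using service[OF j, of n] by (simp add: queue_input_def)
qed

lemma distr_queue_input:
  assumes j: "j < c"
  shows "distr M input_space (queue_input j) = input"
proof -
  let ?K = "\<lambda>n. {Interarrival j n, Service j n}"
  have "indep_vars (\<lambda>n. PiM (?K n) (\<lambda>_. borel)) (\<lambda>n \<omega>. \<lambda>i\<in>?K n. source_var i \<omega>) UNIV"
    by (rule indep_vars_restrict[OF indep_source_vars])
       (use j in \<open>auto simp: sources_def disjoint_family_on_def\<close>)
  then have "indep_vars (\<lambda>_. borel \<Otimes>\<^sub>M borel)
     (\<lambda>n \<omega>. (\<lambda>x. (x (Interarrival j n), x (Service j n))) (\<lambda>i\<in>?K n. source_var i \<omega>)) UNIV"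
  proof (rule indep_vars_compose2)
    fix n
    have "(\<lambda>x. x i) \<in> borel_measurable (PiM (?K n) (\<lambda>_. borel))" if "i \<in> ?K n" for i
      by (rule measurable_component_singleton) fact
    then show "(\<lambda>x. (x (Interarrival j n), x (Service j n))) \<in> PiM (?K n) (\<lambda>_. borel) \<rightarrow>\<^sub>M borel \<Otimes>\<^sub>M borel"
      by (intro measurable_Pair) auto
  qed
  then have "indep_vars (\<lambda>_. borel \<Otimes>\<^sub>M borel) (\<lambda>n \<omega>. queue_input j \<omega> n) UNIV"
    by (simp add: queue_input_def source_var_def)
  then have "distr M (PiM UNIV (\<lambda>_. borel \<Otimes>\<^sub>M borel)) (\<lambda>\<omega>. \<lambda>n\<in>UNIV. queue_input j \<omega> n) =
      PiM UNIV (\<lambda>n. distr M (borel \<Otimes>\<^sub>M borel) (\<lambda>\<omega>. queue_input j \<omega> n))"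
  proof (subst indep_vars_iff_distr_eq_PiM'[symmetric])
    show "(\<lambda>\<omega>. queue_input j \<omega> n) \<in> M \<rightarrow>\<^sub>M borel \<Otimes>\<^sub>M borel" for n
      using measurable_input_component[OF queue_input_measurable[OF j]] .
  qed auto
  then show ?thesis by (simp add: distr_mark[OF j] input_def restrict_UNIV)
qed

lemma inputs_measurable [measurable]: "inputs \<in> M \<rightarrow>\<^sub>M PiM {..<c} (\<lambda>_. input)"
  unfolding inputs_def[abs_def]
  by (rule measurable_restrict) (simp add: measurable_cong_sets[OF refl sets_input] queue_input_measurable)

lemma initial_work_measurable [measurable]: "initial_work \<in> M \<rightarrow>\<^sub>M PiM {..<c} (\<lambda>_. borel)"
  unfolding initial_work_def[abs_def]
  by (rule measurable_restrict) (simp add: total_work_initial_measurable)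

lemma measurable_select_input:
  assumes "\<And>n. Interarrival j n \<in> K \<and> Service j n \<in> K"
  shows "(\<lambda>x n. (x (Interarrival j n), x (Service j n))) \<in> PiM K (\<lambda>_. borel) \<rightarrow>\<^sub>M input"
  unfolding measurable_cong_sets[OF refl sets_input]
  by (rule measurable_abs_UNIV)
     (intro measurable_Pair measurable_component_singleton conjunct1[OF assms] conjunct2[OF assms])

lemma distr_inputs: "distr M (PiM {..<c} (\<lambda>_. input)) inputs = PiM {..<c} (\<lambda>_. input)"
proof -
  let ?K = "\<lambda>j. range (Interarrival j) \<union> range (Service j)"
  have "indep_vars (\<lambda>j. PiM (?K j) (\<lambda>_. borel)) (\<lambda>j \<omega>. \<lambda>i\<in>?K j. source_var i \<omega>) {..<c}"
    by (rule indep_vars_restrict[OF indep_source_vars])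
       (auto simp: sources_def disjoint_family_on_def)
  then have "indep_vars (\<lambda>_. input)
     (\<lambda>j \<omega>. (\<lambda>x n. (x (Interarrival j n), x (Service j n))) (\<lambda>i\<in>?K j. source_var i \<omega>)) {..<c}"
    by (rule indep_vars_compose2) (rule measurable_select_input, auto)
  then have "indep_vars (\<lambda>_. input) queue_input {..<c}"
    by (simp add: queue_input_def[abs_def] source_var_def)
  moreover have "{..<c} \<noteq> {}" using servers by (auto simp: lessThan_empty_iff)
  ultimately have "distr M (PiM {..<c} (\<lambda>_. input)) (\<lambda>\<omega>. \<lambda>j\<in>{..<c}. queue_input j \<omega>) =
      PiM {..<c} (\<lambda>j. distr M input (queue_input j))"
    by (subst indep_vars_iff_distr_eq_PiM'[symmetric])
       (auto simp: measurable_cong_sets[OF refl sets_input] queue_input_measurable)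
  also have "\<dots> = PiM {..<c} (\<lambda>_. input)"
  proof (rule PiM_cong)
    fix j assume "j \<in> {..<c}"
    then show "distr M input (queue_input j) = input"
      using distr_queue_input[of j] distr_cong[OF refl sets_input, of M "queue_input j" "queue_input j"] by simp
  qed simp
  finally show ?thesis unfolding inputs_def .
qed

text \<open>Initial workloads and inputs are functions of two disjoint blocks of sources.
  Independence of the blocks makes the joint law a product, whose second factor is given by
  \<open>distr_inputs\<close>.\<close>

lemma nn_integral_joint:
  assumes [measurable]: "F \<in> borel_measurable (PiM {..<c} (\<lambda>_. borel) \<Otimes>\<^sub>M PiM {..<c} (\<lambda>_. input))"
  shows "(\<integral>\<^sup>+\<omega>. F (initial_work \<omega>, inputs \<omega>) \<partial>M) =
    (\<integral>\<^sup>+\<omega>. \<integral>\<^sup>+\<iota>. F (initial_work \<omega>, \<iota>) \<partial>PiM {..<c} (\<lambda>_. input) \<partial>M)"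
proof -
  let ?A = "Initial ` {..<c}" and ?B = "\<Union>j<c. range (Interarrival j) \<union> range (Service j)"
  let ?PA = "PiM ?A (\<lambda>_. borel) :: (source \<Rightarrow> real) measure" and ?PB = "PiM ?B (\<lambda>_. borel) :: (source \<Rightarrow> real) measure"
  let ?I = "PiM {..<c} (\<lambda>_. input)"
  define RA where "RA \<omega> = (\<lambda>i\<in>?A. source_var i \<omega>)" for \<omega>
  define RB where "RB \<omega> = (\<lambda>i\<in>?B. source_var i \<omega>)" for \<omega>
  define f where "f x = (\<lambda>j\<in>{..<c}. x (Initial j))" for x :: "source \<Rightarrow> real"
  define g where "g x = (\<lambda>j\<in>{..<c}. \<lambda>n. (x (Interarrival j n), x (Service j n)))" for x :: "source \<Rightarrow> real"
  have indep: "indep_var ?PA RA ?PB RB"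
    unfolding RA_def[abs_def] RB_def[abs_def]
    by (rule indep_var_restrict[OF indep_source_vars]) (auto simp: sources_def)
  then have RA [measurable]: "RA \<in> M \<rightarrow>\<^sub>M ?PA" and RB [measurable]: "RB \<in> M \<rightarrow>\<^sub>M ?PB"
    by (auto dest: indep_var_rv1 indep_var_rv2)
  have f [measurable]: "f \<in> ?PA \<rightarrow>\<^sub>M PiM {..<c} (\<lambda>_. borel)"
    unfolding f_def[abs_def] by (intro measurable_restrict measurable_component_singleton) auto
  have g [measurable]: "g \<in> ?PB \<rightarrow>\<^sub>M ?I"
    unfolding g_def[abs_def] by (intro measurable_restrict measurable_select_input) auto
  have fR: "f (RA \<omega>) = initial_work \<omega>" for \<omega>
    by (auto simp: fun_eq_iff f_def RA_def initial_work_def source_var_def restrict_def)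
  have gR: "g (RB \<omega>) = inputs \<omega>" for \<omega>
    by (auto simp: fun_eq_iff g_def RB_def inputs_def queue_input_def source_var_def restrict_def)
  interpret I: prob_space ?I by (intro prob_space_PiM input.prob_space_axioms)
  interpret B: prob_space "distr M ?PB RB" by (rule prob_space_distr) (rule RB)
  have eq: "distr M (?PA \<Otimes>\<^sub>M ?PB) (\<lambda>\<omega>. (RA \<omega>, RB \<omega>)) = distr M ?PA RA \<Otimes>\<^sub>M distr M ?PB RB"
    using indep by (simp add: indep_var_distribution_eq)
  have "(\<integral>\<^sup>+\<omega>. F (initial_work \<omega>, inputs \<omega>) \<partial>M) = (\<integral>\<^sup>+\<omega>. F (f (fst (RA \<omega>, RB \<omega>)), g (snd (RA \<omega>, RB \<omega>))) \<partial>M)"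
    by (simp add: fR gR)
  also have "\<dots> = (\<integral>\<^sup>+p. F (f (fst p), g (snd p)) \<partial>distr M (?PA \<Otimes>\<^sub>M ?PB) (\<lambda>\<omega>. (RA \<omega>, RB \<omega>)))"
    by (rule nn_integral_distr[symmetric]) measurable
  also have "\<dots> = (\<integral>\<^sup>+x. \<integral>\<^sup>+y. F (f x, g y) \<partial>distr M ?PB RB \<partial>distr M ?PA RA)"
    unfolding eq by (subst B.nn_integral_fst[symmetric]) simp_all
  also have "\<dots> = (\<integral>\<^sup>+\<omega>. \<integral>\<^sup>+y. F (f (RA \<omega>), g y) \<partial>distr M ?PB RB \<partial>M)"
    by (rule nn_integral_distr) measurable
  also have "\<dots> = (\<integral>\<^sup>+\<omega>. \<integral>\<^sup>+\<iota>. F (initial_work \<omega>, \<iota>) \<partial>?I \<partial>M)"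
  proof (rule nn_integral_cong)
    fix \<omega> assume "\<omega> \<in> space M"
    then have [simp]: "initial_work \<omega> \<in> space (PiM {..<c} (\<lambda>_. borel))"
      by (rule measurable_space[OF initial_work_measurable])
    have "(\<integral>\<^sup>+y. F (f (RA \<omega>), g y) \<partial>distr M ?PB RB) = (\<integral>\<^sup>+\<omega>'. F (initial_work \<omega>, inputs \<omega>') \<partial>M)"
      unfolding fR by (subst nn_integral_distr) (simp_all add: gR)
    also have "\<dots> = (\<integral>\<^sup>+\<iota>. F (initial_work \<omega>, \<iota>) \<partial>distr M ?I inputs)"
      by (rule nn_integral_distr[symmetric]) measurable
    finally show "(\<integral>\<^sup>+y. F (f (RA \<omega>), g y) \<partial>distr M ?PB RB) = (\<integral>\<^sup>+\<iota>. F (initial_work \<omega>, \<iota>) \<partial>?I)"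
      by (simp add: distr_inputs)
  qed
  finally show ?thesis .
qed

section \<open>Workload representation of the queues and stationarity\<close>

lemma AE_inputs_regular: "AE \<omega> in M. \<forall>j<c. regular (inputs \<omega> j)"
proof -
  have "AE \<omega> in M. regular (queue_input j \<omega>)" if "j < c" for j
    using AE_regular unfolding distr_queue_input[OF that, symmetric]
    by (rule AE_distrD[OF queue_input_measurable[OF that]])
  then have "AE \<omega> in M. \<forall>j\<in>{..<c}. regular (queue_input j \<omega>)"
    by (intro eventually_ball_finite) auto
  then show ?thesis by eventually_elim (simp add: inputs_def)
qed

text \<open>One null set serves all times, as an infimum over \<open>t\<close> requires. Positive
  residuals make a zero workload equivalent to an empty configuration.\<close>

lemma AE_queue_workload:
  "AE \<omega> in M. (\<forall>j<c. regular (inputs \<omega> j)) \<and> (\<forall>j<c. \<forall>t\<ge>0.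
     total_work (ps_queue X A S j t \<omega>) = workload (initial_work \<omega> j) (inputs \<omega> j) t \<and>
     (ps_queue X A S j t \<omega> = {#} \<longleftrightarrow> workload (initial_work \<omega> j) (inputs \<omega> j) t = 0))"
proof -
  have "AE \<omega> in M. \<forall>j\<in>{..<c}. \<forall>x\<in>#X j \<omega>. 0 < x"
    using initial_pos by (intro eventually_ball_finite) auto
  with AE_inputs_regular show ?thesis
  proof eventually_elim
    case (elim \<omega>)
    have "total_work (ps_queue X A S j t \<omega>) = workload (initial_work \<omega> j) (inputs \<omega> j) t \<and>
     (ps_queue X A S j t \<omega> = {#} \<longleftrightarrow> workload (initial_work \<omega> j) (inputs \<omega> j) t = 0)"
      if "j < c" "0 \<le> t" for j t
    proof -
      have r: "regular (inputs \<omega> j)" and p: "\<forall>x\<in>#X j \<omega>. 0 < x" using elim that by auto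
      have q: "ps_queue X A S j t \<omega> = ps_path (X j \<omega>) (\<lambda>n. fst (inputs \<omega> j n)) (\<lambda>n. snd (inputs \<omega> j n)) t"
        using that by (simp add: ps_queue_def inputs_def queue_input_def)
      have i: "initial_work \<omega> j = sum_mset (X j \<omega>)"
        using that p by (simp add: initial_work_def total_work_eq)
      show ?thesis
        using ps_path_workload[OF p r that(2)] sum_mset_pos_eq_0[of "ps_queue X A S j t \<omega>"]
        unfolding q i by (simp add: total_work_eq)
    qed
    then show ?case using elim by blast
  qed
qed

text \<open>Equal laws of the configurations at times 0 and 1 give equal laws of the total work.
  Independence of initial state and inputs then puts this into the kernel form that the moment
  estimates assume.\<close>

lemma stationary_workload:
  assumes j: "j < c" and [measurable]: "f \<in> borel_measurable borel"
  shows "(\<integral>\<^sup>+w. \<integral>\<^sup>+z. f (workload w z 1) \<partial>input \<partial>distr M borel (\<lambda>\<omega>. initial_work \<omega> j)) =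
    (\<integral>\<^sup>+w. f w \<partial>distr M borel (\<lambda>\<omega>. initial_work \<omega> j))"
proof -
  let ?Y = "ps_queue X A S j"
  have Y: "?Y t \<in> M \<rightarrow>\<^sub>M config_space" "distr M config_space (?Y t) = distr M config_space (?Y 0)" if "0 \<le> t" for t
    using equilibrium[OF j] that unfolding in_equilibrium_def by blast+
  have jc: "j \<in> {..<c}" using j by simp
  have w [measurable]: "(\<lambda>\<omega>. initial_work \<omega> j) \<in> borel_measurable M"
    using measurable_compose[OF initial_work_measurable measurable_component_singleton[OF jc]] .
  have fm: "(\<lambda>x. f (total_work x)) \<in> borel_measurable config_space" by measurable
  have all: "(\<integral>\<^sup>+\<omega>. f (workload (initial_work \<omega> j) (inputs \<omega> j) t) \<partial>M) =
      (\<integral>\<^sup>+x. f (total_work x) \<partial>distr M config_space (?Y 0))" if "0 \<le> t" for t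
  proof -
    have "(\<integral>\<^sup>+\<omega>. f (workload (initial_work \<omega> j) (inputs \<omega> j) t) \<partial>M) = (\<integral>\<^sup>+\<omega>. f (total_work (?Y t \<omega>)) \<partial>M)"
      using AE_queue_workload by (intro nn_integral_cong_AE, eventually_elim) (use j that in simp)
    also have "\<dots> = (\<integral>\<^sup>+x. f (total_work x) \<partial>distr M config_space (?Y t))"
      using Y(1)[OF that] fm by (intro nn_integral_distr[symmetric]) auto
    finally show ?thesis unfolding Y(2)[OF that] .
  qed
  have "(\<integral>\<^sup>+w. \<integral>\<^sup>+z. f (workload w z 1) \<partial>input \<partial>distr M borel (\<lambda>\<omega>. initial_work \<omega> j)) =
     (\<integral>\<^sup>+\<omega>. \<integral>\<^sup>+z. f (workload (initial_work \<omega> j) z 1) \<partial>input \<partial>M)"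
    by (rule nn_integral_distr) measurable
  also have "\<dots> = (\<integral>\<^sup>+\<omega>. \<integral>\<^sup>+\<iota>. f (workload (initial_work \<omega> j) (\<iota> j) 1) \<partial>PiM {..<c} (\<lambda>_. input) \<partial>M)"
    by (intro nn_integral_cong nn_integral_PiM_component[symmetric, OF jc]) measurable
  also have "\<dots> = (\<integral>\<^sup>+\<omega>. f (workload (initial_work \<omega> j) (inputs \<omega> j) 1) \<partial>M)"
  proof -
    have "(\<lambda>p. f (workload (fst p j) (snd p j) 1)) \<in> borel_measurable (PiM {..<c} (\<lambda>_. borel) \<Otimes>\<^sub>M PiM {..<c} (\<lambda>_. input))"
      using jc by measurable
    from nn_integral_joint[OF this] show ?thesis by simp
  qed
  also have "\<dots> = (\<integral>\<^sup>+\<omega>. f (workload (initial_work \<omega> j) (inputs \<omega> j) 0) \<partial>M)"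
    using all[of 0] all[of 1] by simp
  also have "\<dots> = (\<integral>\<^sup>+\<omega>. f (initial_work \<omega> j) \<partial>M)"
    using AE_inputs_regular
    by (intro nn_integral_cong_AE, eventually_elim)
       (use j in \<open>simp add: workload_0 initial_work_def total_work_nonneg\<close>)
  also have "\<dots> = (\<integral>\<^sup>+w. f w \<partial>distr M borel (\<lambda>\<omega>. initial_work \<omega> j))"
    by (rule nn_integral_distr[symmetric]) measurable
  finally show ?thesis .
qed

section \<open>The two implications\<close>

lemma initial_work_nonneg: "j < c \<Longrightarrow> 0 \<le> initial_work \<omega> j"
  by (simp add: initial_work_def total_work_nonneg)

lemma initial_work_component_measurable: "j < c \<Longrightarrow> (\<lambda>\<omega>. initial_work \<omega> j) \<in> borel_measurable M"
  using measurable_compose[OF initial_work_measurable measurable_component_singleton[of j "{..<c}"]] by simp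

lemma square_finite_of_mean_empty_time:
  assumes "(\<integral>\<^sup>+\<omega>. all_empty_time c (ps_queue X A S) \<omega> \<partial>M) < \<infinity>"
  shows "(\<integral>\<^sup>+x. ennreal (x\<^sup>2) \<partial>G) < \<infinity>"
proof -
  have 0: "0 < c" using servers by simp
  note [measurable] = initial_work_component_measurable[OF 0]
  let ?\<mu> = "distr M borel (\<lambda>\<omega>. initial_work \<omega> 0)"
  have "(\<integral>\<^sup>+w. ennreal w \<partial>?\<mu>) = (\<integral>\<^sup>+\<omega>. ennreal (initial_work \<omega> 0) \<partial>M)"
    by (rule nn_integral_distr) measurable
  also have "\<dots> \<le> (\<integral>\<^sup>+\<omega>. all_empty_time c (ps_queue X A S) \<omega> \<partial>M)"
  proof (rule nn_integral_mono_AE)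
    show "AE \<omega> in M. ennreal (initial_work \<omega> 0) \<le> all_empty_time c (ps_queue X A S) \<omega>"
      using AE_queue_workload
    proof eventually_elim
      case (elim \<omega>)
      \<comment> \<open>Queue \<open>0\<close> alone gives the bound. If the queues are never empty
        together, the infimum is infinite and nothing is to be shown.\<close>
      have "initial_work \<omega> 0 \<le> t" if "0 \<le> t" "\<forall>j<c. ps_queue X A S j t \<omega> = {#}" for t
        using that elim 0 workload_ge_drain[of "inputs \<omega> 0" t "initial_work \<omega> 0"] by auto
      then show ?case
        unfolding all_empty_time_def by (intro INF_greatest ennreal_leI) auto
    qed
  qed
  finally have mean: "(\<integral>\<^sup>+w. ennreal w \<partial>?\<mu>) < \<infinity>" using assms by (rule le_less_trans)
  show ?thesis
    by (rule stationary_mean_imp_square_finite[OF prob_space_distr _ _ stationary_workload[OF 0] mean])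
       (auto simp: AE_distr_iff initial_work_nonneg[OF 0])
qed

text \<open>The second moment of \<open>G\<close> enters twice: through the drift of the norm, and
  through the finite stationary means of the initial workloads, in which the Lyapunov bound is
  linear.\<close>

lemma mean_empty_time_finite:
  assumes int: "integrable G (\<lambda>x. x)" and stable: "r * (\<integral>x. x \<partial>G) < 1"
    and square: "(\<integral>\<^sup>+x. ennreal (x\<^sup>2) \<partial>G) < \<infinity>"
  shows "(\<integral>\<^sup>+\<omega>. all_empty_time c (ps_queue X A S) \<omega> \<partial>M) < \<infinity>"
proof -
  define m where "m = (\<integral>x. x \<partial>G)"
  define q where "q = enn2real (\<integral>\<^sup>+x. ennreal (x\<^sup>2) \<partial>G)"
  have pos: "AE x in G. 0 \<le> x" using service_pos by eventually_elim simp
  have m: "0 \<le> m" unfolding m_def using pos by (rule integral_nonneg_AE)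
  have mean: "(\<integral>\<^sup>+x. ennreal x \<partial>G) \<le> ennreal m"
    unfolding m_def using nn_integral_eq_integral[OF int pos] by simp
  have q: "0 \<le> q" by (simp add: q_def)
  have sq: "(\<integral>\<^sup>+x. ennreal (x\<^sup>2) \<partial>G) \<le> ennreal q"
    using square by (simp add: q_def)
  have st: "r * m < 1" using stable by (simp add: m_def)
  let ?B = "PiM {..<c} (\<lambda>_. borel) :: (nat \<Rightarrow> real) measure" and ?I = "PiM {..<c} (\<lambda>_. input)"
  obtain len U C D where len [measurable]: "len \<in> borel_measurable ?B" and U [measurable]: "U \<in> borel_measurable ?B"
    and len1: "\<And>w. 1 \<le> len w" and U_le: "\<And>w. U w \<le> ennreal C * ennreal (L2_set w {..<c}) + ennreal D"
    and lyapunov: "\<And>w. \<forall>j<c. 0 \<le> w j \<Longrightarrow> \<exists>j<c. w j \<noteq> 0 \<Longrightarrow>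
      ennreal (len w) + (\<integral>\<^sup>+\<iota>. U (\<lambda>j\<in>{..<c}. workload (w j) (\<iota> j) (len w)) \<partial>?I) \<le> U w"
    using exists_lyapunov[OF m mean st q sq servers]
    by (elim exE conjE) (rule that, assumption, assumption, erule spec, erule spec, blast)
  have len0: "0 \<le> len w" for w using len1[of w] by simp
  let ?E = "\<lambda>n \<omega>. elapsed c len n (initial_work \<omega>) (inputs \<omega>)"
  have inputs': "inputs \<in> M \<rightarrow>\<^sub>M PiM {..<c} (\<lambda>_. input_space)"
    using inputs_measurable unfolding measurable_cong_sets[OF refl sets_PiM_cong[OF refl sets_input]] .
  have [measurable]: "?E n \<in> borel_measurable M" for n
    by (rule measurable_elapsed[OF len initial_work_measurable inputs'])
  have "(\<integral>\<^sup>+\<omega>. all_empty_time c (ps_queue X A S) \<omega> \<partial>M) \<le> (\<integral>\<^sup>+\<omega>. (SUP n. ?E n \<omega>) \<partial>M)"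
  proof (rule nn_integral_mono_AE)
    show "AE \<omega> in M. all_empty_time c (ps_queue X A S) \<omega> \<le> (SUP n. ?E n \<omega>)"
      using AE_queue_workload
    proof eventually_elim
      case (elim \<omega>)
      have dom: "ennreal (real n) \<le> ?E n \<omega> \<or> (\<exists>t\<ge>0. ennreal t \<le> ?E n \<omega> \<and>
          (\<forall>j<c. workload (initial_work \<omega> j) (inputs \<omega> j) t = 0))" for n
        by (rule elapsed_dominates) (use elim len1 initial_work_nonneg in auto)
      \<comment> \<open>Either \<open>elapsed\<close> keeps up with every \<open>n\<close> and the
        supremum is infinite, or for some \<open>n\<close> it bounds a time at which all queues are
        empty.\<close>
      show ?case
      proof (cases "\<forall>n. ennreal (real n) \<le> ?E n \<omega>")
        case True
        have "top = (SUP n. of_nat n :: ennreal)" by (rule ennreal_SUP_of_nat_eq_top[symmetric])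
        also have "\<dots> \<le> (SUP n. ?E n \<omega>)"
          using True by (intro SUP_mono) (auto simp: ennreal_of_nat_eq_real_of_nat)
        finally have "(SUP n. ?E n \<omega>) = top" by (rule top_unique[THEN iffD1])
        then show ?thesis by (simp only: top_greatest)
      next
        case False
        then obtain n t where t: "0 \<le> t" "ennreal t \<le> ?E n \<omega>"
            "\<forall>j<c. workload (initial_work \<omega> j) (inputs \<omega> j) t = 0"
          using dom by blast
        then have "all_empty_time c (ps_queue X A S) \<omega> \<le> ennreal t"
          unfolding all_empty_time_def using elim by (intro INF_lower) auto
        also have "\<dots> \<le> (SUP n. ?E n \<omega>)"
          using t(2) by (rule SUP_upper2[OF UNIV_I])
        finally show ?thesis .
      qed
    qed
  qed
  also have "\<dots> = (SUP n. \<integral>\<^sup>+\<omega>. ?E n \<omega> \<partial>M)"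
  proof (rule nn_integral_monotone_convergence_SUP)
    show "incseq ?E" by (rule incseq_SucI) (rule le_funI, rule elapsed_mono)
  qed measurable
  also have "\<dots> \<le> (\<integral>\<^sup>+\<omega>. U (initial_work \<omega>) \<partial>M)"
  proof (rule SUP_least)
    fix n
    have F: "(\<lambda>p. elapsed c len n (fst p) (snd p)) \<in> borel_measurable (?B \<Otimes>\<^sub>M ?I)"
      by (subst measurable_cong_sets[OF sets_pair_measure_cong[OF refl sets_PiM_cong[OF refl sets_input]] refl])
         measurable
    have "(\<integral>\<^sup>+\<omega>. ?E n \<omega> \<partial>M) = (\<integral>\<^sup>+\<omega>. \<integral>\<^sup>+\<iota>. elapsed c len n (initial_work \<omega>) \<iota> \<partial>?I \<partial>M)"
      using nn_integral_joint[OF F] by simp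
    also have "\<dots> \<le> (\<integral>\<^sup>+\<omega>. U (initial_work \<omega>) \<partial>M)"
    proof (rule nn_integral_mono)
      fix \<omega> assume "\<omega> \<in> space M"
      then have sp: "initial_work \<omega> \<in> space ?B" by (rule measurable_space[OF initial_work_measurable])
      have ly: "ennreal (len w) + (\<integral>\<^sup>+\<iota>. U (\<lambda>j\<in>{..<c}. workload (w j) (\<iota> j) (len w)) \<partial>?I) \<le> U w"
        if "\<And>j. j < c \<Longrightarrow> 0 \<le> w j" "\<exists>j<c. w j \<noteq> 0" for w
        by (rule lyapunov) (use that in blast)+
      show "(\<integral>\<^sup>+\<iota>. elapsed c len n (initial_work \<omega>) \<iota> \<partial>?I) \<le> U (initial_work \<omega>)"
        by (rule nn_integral_elapsed_le[OF len U len0 ly initial_work_nonneg sp])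
    qed
    finally show "(\<integral>\<^sup>+\<omega>. ?E n \<omega> \<partial>M) \<le> (\<integral>\<^sup>+\<omega>. U (initial_work \<omega>) \<partial>M)" .
  qed
  also have "\<dots> \<le> (\<integral>\<^sup>+\<omega>. ennreal C * (\<Sum>j<c. ennreal (initial_work \<omega> j)) + ennreal D \<partial>M)"
  proof (rule nn_integral_mono)
    fix \<omega>
    have "L2_set (initial_work \<omega>) {..<c} \<le> (\<Sum>j<c. initial_work \<omega> j)"
      by (rule L2_set_le_sum) (simp add: initial_work_nonneg)
    then have "ennreal (L2_set (initial_work \<omega>) {..<c}) \<le> ennreal (\<Sum>j<c. initial_work \<omega> j)"
      by (rule ennreal_leI)
    also have "\<dots> = (\<Sum>j<c. ennreal (initial_work \<omega> j))"
      by (rule sum_ennreal[symmetric]) (simp add: initial_work_nonneg)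
    finally have "ennreal (L2_set (initial_work \<omega>) {..<c}) \<le> (\<Sum>j<c. ennreal (initial_work \<omega> j))" .
    then show "U (initial_work \<omega>) \<le> ennreal C * (\<Sum>j<c. ennreal (initial_work \<omega> j)) + ennreal D"
      by (intro order_trans[OF U_le] add_right_mono mult_left_mono) auto
  qed
  also have "\<dots> = ennreal C * (\<Sum>j<c. \<integral>\<^sup>+\<omega>. ennreal (initial_work \<omega> j) \<partial>M) + ennreal D"
  proof -
    have [measurable]: "(\<lambda>\<omega>. ennreal (initial_work \<omega> j)) \<in> borel_measurable M" if "j \<in> {..<c}" for j
      using initial_work_component_measurable[of j] that by simp
    have [measurable]: "(\<lambda>\<omega>. \<Sum>j<c. ennreal (initial_work \<omega> j)) \<in> borel_measurable M"
      by (rule borel_measurable_sum) measurable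
    have "(\<integral>\<^sup>+\<omega>. ennreal C * (\<Sum>j<c. ennreal (initial_work \<omega> j)) + ennreal D \<partial>M) =
       ennreal C * (\<integral>\<^sup>+\<omega>. (\<Sum>j<c. ennreal (initial_work \<omega> j)) \<partial>M) + ennreal D"
      using emeasure_space_1 by (simp add: nn_integral_add nn_integral_cmult)
    also have "(\<integral>\<^sup>+\<omega>. (\<Sum>j<c. ennreal (initial_work \<omega> j)) \<partial>M) = (\<Sum>j<c. \<integral>\<^sup>+\<omega>. ennreal (initial_work \<omega> j) \<partial>M)"
      by (rule nn_integral_sum) measurable
    finally show ?thesis .
  qed
  also have "\<dots> < \<infinity>"
  proof -
    have "(\<integral>\<^sup>+\<omega>. ennreal (initial_work \<omega> j) \<partial>M) < \<infinity>" if j: "j < c" for j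
    proof -
      note [measurable] = initial_work_component_measurable[OF j]
      have "(\<integral>\<^sup>+\<omega>. ennreal (initial_work \<omega> j) \<partial>M) = (\<integral>\<^sup>+w. ennreal w \<partial>distr M borel (\<lambda>\<omega>. initial_work \<omega> j))"
        by (rule nn_integral_distr[symmetric]) measurable
      also have "\<dots> < \<infinity>"
        by (rule stationary_mean_finite[OF m mean st q sq prob_space_distr _ _ stationary_workload[OF j]])
           (auto simp: AE_distr_iff initial_work_nonneg[OF j])
      finally show ?thesis .
    qed
    then show ?thesis by (simp add: ennreal_mult_less_top)
  qed
  finally show ?thesis .
qed

end

theorem mainTheorem3:
  fixes c :: nat and lam :: real and G :: "real measure" and M :: "'w measure"
    and X :: "nat \<Rightarrow> 'w \<Rightarrow> real multiset"
    and A S :: "nat \<Rightarrow> nat \<Rightarrow> 'w \<Rightarrow> real"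
  assumes "c \<ge> 1" and "lam > 0"
    and "real_distribution G" and "AE x in G. 0 < x"
    and "integrable G (\<lambda>x. x)" and "lam * (\<integral>x. x \<partial>G) < real c"
    and "mg1_ps_system M c (lam / real c) G X A S"
    and "\<And>j. j < c \<Longrightarrow> in_equilibrium M (ps_queue X A S j)"
  shows "(\<integral>\<^sup>+\<omega>. all_empty_time c (ps_queue X A S) \<omega> \<partial>M) < \<infinity>
    \<longleftrightarrow> (\<integral>\<^sup>+x. ennreal (x\<^sup>2) \<partial>G) < \<infinity>"
proof -
  have "mg1_input (lam / real c) G"
    using assms(1-4) by (intro mg1_input.intro) simp_all
  then have sys: "stationary_ps_system M c (lam / real c) G X A S"
    by (intro stationary_ps_system.intro stationary_ps_system_axioms.intro assms)
  have stable: "lam / real c * (\<integral>x. x \<partial>G) < 1"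
    using assms(1,6) by (simp add: field_simps)
  show ?thesis
    by (rule iffI[OF stationary_ps_system.square_finite_of_mean_empty_time[OF sys]
          stationary_ps_system.mean_empty_time_finite[OF sys assms(5) stable]])
qed

end
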